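(* Let $k\geq 1$ be an integer, $n=18k+2$, and let $H_k$ be the graph on the vertex set $\{0,1,\ldots,n-1\}$ consisting of all $n$ boundary edges of the convex polygon with vertices $0,1,\ldots,n-1$ in this cyclic order, together with the $18k-1$ chords $$\mathcal{C}(H_k)=\{\{n-3,n-1\}\}\ \cup\ \{R_i:0\leq i\leq k-1\}\ \cup\ \bigcup_{i=0}^{k-2}\mathcal{B}_i\ \cup\ \Gamma ,$$ where $R_i$, $\mathcal{B}_i$ and $\Gamma$ are the explicit chords and sets of chords given in the context. Then $H_k$ is a maximal outerplanar graph with degree sequence $$2^{(8k)}\ 3^{(2)}\ 5^{(8k)}\ 6^{(2)}\ 8^{(2k-2)}$$ (the exponent in parentheses is the multiplicity of the degree), and $$\mathrm{sp}(H_k,2)=8k+2=\frac{4n+10}{9}.$$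
   Context: For a graph $G$ and $B\subseteq V(G)$ the spread is $\mathrm{sp}(B)=\max_{u\in B}\deg_G(u)-\min_{v\in B}\deg_G(v)$, and $\mathrm{sp}(G,2)$ is the largest cardinality of a set $B\subseteq V(G)$ with $\mathrm{sp}(B)\leq 2$. A graph is maximal outerplanar if it is outerplanar and the addition of any edge destroys outerplanarity; equivalently, for order $n\geq 3$, it is a triangulation of a convex $n$-gon. The boundary edges are $\{i,i+1\}$ for $0\leq i\leq n-2$ together with $\{0,n-1\}$. Put $a_i=9i$ and $b_i=18k-1-9i$ for $0\leq i\leq k-2$, and $c=9k-9$. The rungs are $R_i=\{a_i,b_i\}$ for $0\leq i\leq k-2$ and $R_{k-1}=\{c,c+17\}$ (for $k=1$ there are no $a_i,b_i$ and the only rung is $R_0=\{0,17\}$). For $0\leq i\leq k-2$ let $\phi_i:\{0,\ldots,19\}\to\{0,\ldots,n-1\}$ be the local labelling $\phi_i(\ell)=a_i+\ell$ for $0\leq\ell\leq 9$ and $\phi_i(10+j)=b_i-9+j$ for $0\leq j\leq 9$. The set $\mathcal{B}_i$ consists of the $17$ chords $\{\phi_i(p),\phi_i(q)\}$ where $\{p,q\}$ is one of $\{0,2\},\{2,4\},\{4,6\},\{6,8\}$; $\{0,11\},\{0,13\},\{0,15\},\{0,17\}$; $\{2,11\},\{4,11\},\{6,11\},\{8,11\}$; $\{11,13\},\{13,15\},\{15,17\},\{17,19\}$; $\{8,10\}$. The set $\Gamma$ consists of the $15$ chords $\{c+x,c+y\}$ with $(x,y)$ one of $(0,13),(0,15),(1,3),(1,12),(1,13),(3,5),(3,10),(3,12),(5,7),(5,10),(7,9),(7,10),(10,12),(13,15),(15,17)$.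 *)

theory Defs
  imports "HOL-Analysis.Analysis" "HOL-Library.Multiset"
begin

definition simple_graph :: "'a set \<Rightarrow> 'a set set \<Rightarrow> bool" where
  "simple_graph V E \<longleftrightarrow> finite V \<and> (\<forall>e\<in>E. e \<subseteq> V \<and> card e = 2)"

definition degree :: "'a set set \<Rightarrow> 'a \<Rightarrow> nat" where
  "degree E v = card {e \<in> E. v \<in> e}"

definition spread :: "'a set set \<Rightarrow> 'a set \<Rightarrow> int" where
  "spread E B = int (Max (degree E ` B)) - int (Min (degree E ` B))"

text \<open>The empty set is left out because \<^const>\<open>Max\<close> and \<^const>\<open>Min\<close> of the empty set are unspecified;
  in a graph with a vertex, singletons have spread 0, so this does not affect the maximum for
  non-negative bounds.\<close>

definition sp :: "'a set \<Rightarrow> 'a set set \<Rightarrow> int \<Rightarrow> nat" where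
  "sp V E r = Max (card ` {B. B \<subseteq> V \<and> B \<noteq> {} \<and> spread E B \<le> r})"

text \<open>The plane is the type of complex numbers: a vertex \<open>v\<close> is drawn at \<open>p v\<close>, an edge \<open>e\<close> along
  the arc \<open>g e\<close>.\<close>

definition plane_drawing ::
    "'a set \<Rightarrow> 'a set set \<Rightarrow> ('a \<Rightarrow> complex) \<Rightarrow> ('a set \<Rightarrow> real \<Rightarrow> complex) \<Rightarrow> bool" where
  "plane_drawing V E p g \<longleftrightarrow>
     inj_on p V \<and>
     (\<forall>e\<in>E. arc (g e) \<and> {pathstart (g e), pathfinish (g e)} = p ` e \<and>
            path_image (g e) \<inter> p ` V \<subseteq> p ` e) \<and>
     (\<forall>e\<in>E. \<forall>e'\<in>E. e \<noteq> e' \<longrightarrow> path_image (g e) \<inter> path_image (g e') \<subseteq> p ` (e \<inter> e'))"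

definition drawn_points ::
    "'a set \<Rightarrow> 'a set set \<Rightarrow> ('a \<Rightarrow> complex) \<Rightarrow> ('a set \<Rightarrow> real \<Rightarrow> complex) \<Rightarrow> complex set" where
  "drawn_points V E p g = p ` V \<union> (\<Union>e\<in>E. path_image (g e))"

text \<open>The drawn points of a finite graph form a compact set, so \<^const>\<open>outside\<close> of it is the unique
  unbounded component of its complement, that is, the outer face.\<close>

definition outerplanar :: "'a set \<Rightarrow> 'a set set \<Rightarrow> bool" where
  "outerplanar V E \<longleftrightarrow> simple_graph V E \<and>
     (\<exists>p g. plane_drawing V E p g \<and> p ` V \<subseteq> frontier (outside (drawn_points V E p g)))"

definition maximal_outerplanar :: "'a set \<Rightarrow> 'a set set \<Rightarrow> bool" where
  "maximal_outerplanar V E \<longleftrightarrow> outerplanar V E \<and>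
     (\<forall>u\<in>V. \<forall>v\<in>V. u \<noteq> v \<and> {u, v} \<notin> E \<longrightarrow> \<not> outerplanar V (insert {u, v} E))"

definition degree_sequence :: "'a set \<Rightarrow> 'a set set \<Rightarrow> nat multiset" where
  "degree_sequence V E = image_mset (degree E) (mset_set V)"

definition boundary_edges :: "nat \<Rightarrow> nat set set" where
  "boundary_edges n = {{i, i + 1} | i. i < n - 1} \<union> {{0, n - 1}}"

text \<open>The graph \<open>H\<^sub>k\<close>. For \<open>k \<ge> 1\<close> and \<open>i < k - 1\<close> all subtractions on \<^typ>\<open>nat\<close> below are exact.\<close>

definition H_order :: "nat \<Rightarrow> nat" where
  "H_order k = 18 * k + 2"

definition H_a :: "nat \<Rightarrow> nat" where
  "H_a i = 9 * i"

definition H_b :: "nat \<Rightarrow> nat \<Rightarrow> nat" where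
  "H_b k i = 18 * k - 1 - 9 * i"

definition H_c :: "nat \<Rightarrow> nat" where
  "H_c k = 9 * k - 9"

definition H_rung :: "nat \<Rightarrow> nat \<Rightarrow> nat set" where
  "H_rung k i = (if i = k - 1 then {H_c k, H_c k + 17} else {H_a i, H_b k i})"

definition H_phi :: "nat \<Rightarrow> nat \<Rightarrow> nat \<Rightarrow> nat" where
  "H_phi k i l = (if l \<le> 9 then H_a i + l else H_b k i - 9 + (l - 10))"

definition H_block :: "nat \<Rightarrow> nat \<Rightarrow> nat set set" where
  "H_block k i = (\<lambda>(p, q). {H_phi k i p, H_phi k i q}) `
     {(0, 2), (2, 4), (4, 6), (6, 8),
      (0, 11), (0, 13), (0, 15), (0, 17),
      (2, 11), (4, 11), (6, 11), (8, 11),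
      (11, 13), (13, 15), (15, 17), (17, 19),
      (8, 10)}"

definition H_Gamma :: "nat \<Rightarrow> nat set set" where
  "H_Gamma k = (\<lambda>(x, y). {H_c k + x, H_c k + y}) `
     {(0, 13), (0, 15), (1, 3), (1, 12), (1, 13), (3, 5), (3, 10), (3, 12),
      (5, 7), (5, 10), (7, 9), (7, 10), (10, 12), (13, 15), (15, 17)}"

definition H_chords :: "nat \<Rightarrow> nat set set" where
  "H_chords k = {{H_order k - 3, H_order k - 1}} \<union> H_rung k ` {..<k} \<union>
     (\<Union>i<k - 1. H_block k i) \<union> H_Gamma k"

definition H_verts :: "nat \<Rightarrow> nat set" where
  "H_verts k = {..<H_order k}"

definition H_edges :: "nat \<Rightarrow> nat set set" where
  "H_edges k = boundary_edges (H_order k) \<union> H_chords k"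

end

theory Submission
  imports Defs "HOL-Complex_Analysis.Complex_Analysis"
begin

text \<open>Place the vertex \<open>v\<close> on the parabola at \<open>v + v\<^sup>2 \<i>\<close>: straight chords with
  non-interlacing ends do not cross, and every vertex sees the unbounded region below the parabola.
  Conversely, in a drawing with all vertices on the outer face the Hamiltonian cycle is a Jordan curve,
  and by the theta-curve argument every chord runs inside it; two interlacing chords would then meet.
  So outerplanarity of a supergraph of the cycle means that no two edges interlace, and a
  non-interlacing graph has at most \<open>2n - 3\<close> edges, which \<open>H\<^sub>k\<close> attains. All properties of \<open>H\<^sub>k\<close>
  follow by induction on \<open>k\<close>: up to a shift by \<open>9\<close>, the graph \<open>H\<^bsub>k + 1\<^esub>\<close> is \<open>H\<^sub>k\<close> without its
  last two vertices, enclosed by one more layer and capped again.\<close>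

section \<open>Theta curves\<close>

text \<open>Maximality is the obstacle: an added edge may be drawn as any arc, so a failure of
  outerplanarity cannot be read off one straight drawing, and this is where the Jordan curve theorem
  is needed. The Hamiltonian cycle makes it manageable by putting all vertices in a known order on
  one closed curve. The last two vertices are set apart because, without them, the outermost rung
  joins the first vertex to the last: each ladder is a triangulated polygon with that rung as a
  side, and a new layer is glued along it. The two vertices raise the degrees of the ends of the
  rung by 1 and 2, and so does a layer placed around it; hence inner degrees are stable. The shift 9
  is half of the 18 vertices of a layer, nine at each end of the numbering. Among the degrees 2, 3,
  5, 6, 8 a window of width 2 never contains both 2 and 5, or both 5 and 8. So the two classes of
  size 8k never combine, and each is joined by at most one class of size 2.\<close>

lemma simple_path_two_arcs:
  assumes "arc \<alpha>" "arc \<beta>" "pathstart \<alpha> = a" "pathfinish \<alpha> = b" "pathstart \<beta> = a" "pathfinish \<beta> = b"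
    and "path_image \<alpha> \<inter> path_image \<beta> = {a, b}"
  shows "simple_path (\<alpha> +++ reversepath \<beta>)"
  using assms by (auto intro!: simple_path_join_loop simp: arc_reversepath)

text \<open>The closed curve is kept as two arcs with common ends because the ends of a chord cut
  the cycle in exactly this way.\<close>

lemma Jordan_two_arcs:
  fixes \<alpha> \<beta> :: "real \<Rightarrow> complex"
  assumes "arc \<alpha>" "arc \<beta>" "pathstart \<alpha> = a" "pathfinish \<alpha> = b" "pathstart \<beta> = a" "pathfinish \<beta> = b"
    and "path_image \<alpha> \<inter> path_image \<beta> = {a, b}"
  defines "C \<equiv> path_image \<alpha> \<union> path_image \<beta>"
  shows "inside C \<noteq> {}" "open (inside C)" "connected (inside C)" "frontier (inside C) = C"
proof -
  have "path_image (\<alpha> +++ reversepath \<beta>) = C"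
    using assms by (simp add: path_image_join)
  then show "inside C \<noteq> {}" "open (inside C)" "connected (inside C)" "frontier (inside C) = C"
    using Jordan_inside_outside[OF simple_path_two_arcs[OF assms(1-7)]] assms by auto
qed

text \<open>The three winding numbers about a point of the first region satisfy
  \<open>w\<^bsub>\<alpha>\<beta>\<^esub> + w\<^bsub>\<beta>\<delta>\<^esub> = w\<^bsub>\<alpha>\<delta>\<^esub>\<close>, and \<open>w\<^bsub>\<alpha>\<beta>\<^esub> \<noteq> 0\<close>, so the point lies
  inside one of the other two curves as well.\<close>

lemma theta_curve_inside:
  fixes \<alpha> \<beta> \<delta> :: "real \<Rightarrow> complex"
  assumes \<alpha>: "arc \<alpha>" "pathstart \<alpha> = a" "pathfinish \<alpha> = b"
    and \<beta>: "arc \<beta>" "pathstart \<beta> = a" "pathfinish \<beta> = b"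
    and \<delta>: "arc \<delta>" "pathstart \<delta> = a" "pathfinish \<delta> = b"
    and \<alpha>\<beta>: "path_image \<alpha> \<inter> path_image \<beta> = {a, b}"
    and \<alpha>\<delta>: "path_image \<alpha> \<inter> path_image \<delta> = {a, b}"
    and \<beta>\<delta>: "path_image \<beta> \<inter> path_image \<delta> = {a, b}"
    and out: "path_image \<delta> \<inter> inside (path_image \<alpha> \<union> path_image \<beta>) = {}"
  shows "path_image \<beta> - {a, b} \<subseteq> inside (path_image \<alpha> \<union> path_image \<delta>) \<or>
         path_image \<alpha> - {a, b} \<subseteq> inside (path_image \<beta> \<union> path_image \<delta>)"
proof -
  let ?A = "path_image \<alpha>" and ?B = "path_image \<beta>" and ?D = "path_image \<delta>"
  note J = Jordan_two_arcs[OF \<alpha>(1) \<beta>(1) \<alpha>(2,3) \<beta>(2,3) \<alpha>\<beta>]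
  obtain z where z: "z \<in> inside (?A \<union> ?B)"
    using J(1) by blast
  have zn: "z \<notin> ?A" "z \<notin> ?B" "z \<notin> ?D"
    using z out inside_no_overlap[of "?A \<union> ?B"] by blast+
  have paths: "path \<alpha>" "path \<beta>" "path \<delta>"
    using \<alpha> \<beta> \<delta> by (auto simp: arc_imp_path)
  have im: "path_image (\<alpha> +++ reversepath \<beta>) = ?A \<union> ?B"
    "path_image (\<alpha> +++ reversepath \<delta>) = ?A \<union> ?D"
    "path_image (\<beta> +++ reversepath \<delta>) = ?B \<union> ?D"
    using \<alpha> \<beta> \<delta> by (simp_all add: path_image_join)
  have w: "winding_number (\<alpha> +++ reversepath \<beta>) z = winding_number \<alpha> z - winding_number \<beta> z"
    "winding_number (\<alpha> +++ reversepath \<delta>) z = winding_number \<alpha> z - winding_number \<delta> z"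
    "winding_number (\<beta> +++ reversepath \<delta>) z = winding_number \<beta> z - winding_number \<delta> z"
    using paths zn \<alpha> \<beta> \<delta> by (simp_all add: winding_number_join winding_number_reversepath)
  have "norm (winding_number (\<alpha> +++ reversepath \<beta>) z) = 1"
    using simple_closed_path_norm_winding_number_inside[OF simple_path_two_arcs] \<alpha> \<beta> \<alpha>\<beta> z im by auto
  then have "winding_number (\<alpha> +++ reversepath \<delta>) z \<noteq> 0 \<or> winding_number (\<beta> +++ reversepath \<delta>) z \<noteq> 0"
    unfolding w by auto
  then have "z \<notin> outside (?A \<union> ?D) \<or> z \<notin> outside (?B \<union> ?D)"
    using winding_number_zero_in_outside[of "\<alpha> +++ reversepath \<delta>" z]
      winding_number_zero_in_outside[of "\<beta> +++ reversepath \<delta>" z] paths \<alpha> \<beta> \<delta> im by auto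
  then have z2: "z \<in> inside (?A \<union> ?D) \<or> z \<in> inside (?B \<union> ?D)"
    using inside_Un_outside[of "?A \<union> ?D"] inside_Un_outside[of "?B \<union> ?D"] zn by blast
  \<comment> \<open>The interior of the first curve is connected and misses \<open>P\<close> and
    \<open>?D\<close>, so it lies in the single region of \<open>z\<close>. Its closure contains its
    frontier, hence \<open>P'\<close>, and away from \<open>a\<close> and \<open>b\<close> the arc
    \<open>P'\<close> avoids the bounding curve.\<close>
  have main: "P' - {a, b} \<subseteq> inside (P \<union> ?D)"
    if "z \<in> inside (P \<union> ?D)" "P \<union> P' = ?A \<union> ?B" "P \<inter> P' = {a, b}" "P' \<inter> ?D = {a, b}" "closed (P \<union> ?D)" for P P'
  proof -
    have disj: "inside (?A \<union> ?B) \<inter> (P \<union> ?D) = {}"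
      using out that(2) inside_no_overlap[of "?A \<union> ?B"] by blast
    have "inside (?A \<union> ?B) \<subseteq> inside (P \<union> ?D)"
    proof
      fix x assume x: "x \<in> inside (?A \<union> ?B)"
      have "connected_component (- (P \<union> ?D)) z x"
        unfolding connected_component_def using J(3) x z disj by blast
      then show "x \<in> inside (P \<union> ?D)"
        using that(1) inside_same_component by blast
    qed
    then have "closure (inside (?A \<union> ?B)) \<subseteq> closure (inside (P \<union> ?D))"
      by (rule closure_mono)
    also have "\<dots> \<subseteq> P \<union> ?D \<union> inside (P \<union> ?D)"
      using closure_inside_subset[OF that(5)] by blast
    finally have "closure (inside (?A \<union> ?B)) \<subseteq> P \<union> ?D \<union> inside (P \<union> ?D)" .
    moreover have "?A \<union> ?B \<subseteq> closure (inside (?A \<union> ?B))"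
      using J(4) by (metis Diff_subset frontier_def)
    ultimately show ?thesis
      using that(2-4) by blast
  qed
  have cl: "closed (?A \<union> ?D)" "closed (?B \<union> ?D)"
    using paths by (auto simp: closed_path_image)
  show ?thesis
    using z2 main[of ?A ?B] main[of ?B ?A] cl \<alpha>\<beta> \<alpha>\<delta> \<beta>\<delta> by (auto simp: Un_commute Int_commute)
qed

text \<open>If \<epsilon> missed \<delta>, its open part, being connected, would stay in one of the
  two regions into which \<delta> splits the interior. The closure of that region touches only one
  of \<alpha> and \<beta> away from \<delta>, but \<epsilon> has an end on each.\<close>

lemma chords_inside_not_disjoint:
  fixes \<alpha> \<beta> \<delta> \<epsilon> :: "real \<Rightarrow> complex"
  assumes \<alpha>: "arc \<alpha>" "pathstart \<alpha> = a" "pathfinish \<alpha> = b"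
    and \<beta>: "arc \<beta>" "pathstart \<beta> = a" "pathfinish \<beta> = b"
    and \<delta>: "arc \<delta>" "pathstart \<delta> = a" "pathfinish \<delta> = b"
    and \<alpha>\<beta>: "path_image \<alpha> \<inter> path_image \<beta> = {a, b}"
    and \<alpha>\<delta>: "path_image \<alpha> \<inter> path_image \<delta> = {a, b}"
    and \<beta>\<delta>: "path_image \<beta> \<inter> path_image \<delta> = {a, b}"
    and in\<delta>: "path_image \<delta> \<inter> inside (path_image \<alpha> \<union> path_image \<beta>) \<noteq> {}"
    and \<epsilon>: "arc \<epsilon>" "pathstart \<epsilon> \<in> path_image \<alpha> - {a, b}" "pathfinish \<epsilon> \<in> path_image \<beta> - {a, b}"
    and in\<epsilon>: "path_image \<epsilon> - {pathstart \<epsilon>, pathfinish \<epsilon>} \<subseteq> inside (path_image \<alpha> \<union> path_image \<beta>)"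
  shows "path_image \<delta> \<inter> path_image \<epsilon> \<noteq> {}"
proof
  assume disj: "path_image \<delta> \<inter> path_image \<epsilon> = {}"
  let ?A = "path_image \<alpha>" and ?B = "path_image \<beta>" and ?D = "path_image \<delta>"
  let ?E = "path_image \<epsilon> - {pathstart \<epsilon>, pathfinish \<epsilon>}"
  have ab: "a \<noteq> b" using \<alpha> arc_distinct_ends by blast
  have sp: "simple_path \<alpha>" "simple_path \<beta>" "simple_path \<delta>" "simple_path \<epsilon>"
    using \<alpha> \<beta> \<delta> \<epsilon> by (simp_all add: arc_imp_simple_path)
  have split: "inside (?A \<union> ?D) \<inter> inside (?B \<union> ?D) = {}"
    "inside (?A \<union> ?D) \<union> inside (?B \<union> ?D) \<union> (?D - {a, b}) = inside (?A \<union> ?B)"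
    using split_inside_simple_closed_curve[OF sp(1) \<alpha>(2,3) sp(2) \<beta>(2,3) sp(3) \<delta>(2,3) ab \<alpha>\<beta> \<alpha>\<delta> \<beta>\<delta> in\<delta>]
    by blast+
  have conn: "connected ?E" and ne: "?E \<noteq> {}"
    using connected_simple_path_endless nonempty_simple_path_endless sp(4) by blast+
  \<comment> \<open>A connected set with more than one point has no isolated points, and deleting
    two points keeps limit points; so the ends of \<epsilon> are limits of its open part.\<close>
  have lim: "w \<in> closure ?E" if w: "w \<in> path_image \<epsilon>" for w
  proof -
    have "w islimpt path_image \<epsilon>"
    proof (rule connected_imp_perfect[OF connected_path_image w])
      show "path \<epsilon>" using \<epsilon> arc_imp_path by blast
      show "path_image \<epsilon> \<noteq> {x}" for x
        using arc_distinct_ends[OF \<epsilon>(1)] pathstart_in_path_image[of \<epsilon>] pathfinish_in_path_image[of \<epsilon>] by auto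
    qed
    then have "w islimpt ?E"
      by (metis finite.emptyI finite.insertI islimpt_Un_finite Un_Diff_cancel2 Un_commute)
    then show ?thesis by (simp add: closure_def)
  qed
  have ends: "pathstart \<epsilon> \<in> closure ?E" "pathfinish \<epsilon> \<in> closure ?E"
    using lim by auto
  have op: "open (inside (?A \<union> ?D))" "open (inside (?B \<union> ?D))"
    using Jordan_two_arcs(2) \<alpha> \<beta> \<delta> \<alpha>\<delta> \<beta>\<delta> by blast+
  have "?E \<subseteq> inside (?A \<union> ?D) \<union> inside (?B \<union> ?D)"
    using in\<epsilon> split(2) disj by blast
  then have "?E \<subseteq> inside (?A \<union> ?D) \<or> ?E \<subseteq> inside (?B \<union> ?D)"
    using connectedD[OF conn op] split(1) by blast
  moreover have clo: "closed (?A \<union> ?D)" "closed (?B \<union> ?D)"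
    using \<alpha> \<beta> \<delta> by (auto simp: closed_path_image arc_imp_path)
  ultimately have "closure ?E \<subseteq> ?A \<union> ?D \<union> inside (?A \<union> ?D) \<or> closure ?E \<subseteq> ?B \<union> ?D \<union> inside (?B \<union> ?D)"
    using closure_inside_subset closure_mono by (metis subset_trans)
  moreover have "inside (?A \<union> ?D) \<inter> (?A \<union> ?B) = {}" "inside (?B \<union> ?D) \<inter> (?A \<union> ?B) = {}"
    using split(2) inside_no_overlap[of "?A \<union> ?B"] by blast+
  moreover have "pathstart \<epsilon> \<notin> ?D" "pathfinish \<epsilon> \<notin> ?D"
    using disj by auto
  ultimately show False
    using ends \<epsilon>(2,3) \<alpha>\<beta> by blast
qed

section \<open>Walks and chords in a plane drawing\<close>

fun walk_edges :: "'a list \<Rightarrow> 'a set set" where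
  "walk_edges (x # y # zs) = insert {x, y} (walk_edges (y # zs))"
| "walk_edges _ = {}"

lemma walk_edges_subset: "e \<in> walk_edges xs \<Longrightarrow> e \<subseteq> set xs"
  by (induction xs rule: walk_edges.induct) auto

lemma walk_edges_cover: "length xs \<ge> 2 \<Longrightarrow> x \<in> set xs \<Longrightarrow> \<exists>e\<in>walk_edges xs. x \<in> e"
proof (induction xs rule: walk_edges.induct)
  case (1 a b zs)
  then show ?case by (cases zs) auto
qed auto

lemma walk_edges_append:
  "xs \<noteq> [] \<Longrightarrow> ys \<noteq> [] \<Longrightarrow>
    walk_edges (xs @ ys) = insert {last xs, hd ys} (walk_edges xs \<union> walk_edges ys)"
proof (induction xs rule: walk_edges.induct)
  case ("2_2" x)
  then show ?case by (cases ys) auto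
qed auto

lemma walk_edges_rev: "walk_edges (rev xs) = walk_edges xs"
proof (induction xs rule: walk_edges.induct)
  case (1 x y zs)
  have "walk_edges (rev (x # y # zs)) = insert {y, x} (walk_edges (rev (y # zs)))"
    using walk_edges_append[of "rev (y # zs)" "[x]"] by simp
  then show ?case using 1 by (simp add: insert_commute)
qed auto

lemma walk_edges_upt: "walk_edges [a..<b] = (\<lambda>i. {i, Suc i}) ` {a..<b - 1}"
proof (induction b)
  case (Suc b)
  show ?case
  proof (cases "a < b")
    case True
    then have "walk_edges [a..<Suc b] = insert {b - 1, b} (walk_edges [a..<b])"
      using walk_edges_append[of "[a..<b]" "[b]"] by (simp add: last_upt)
    moreover have "{a..<b} = insert (b - 1) {a..<b - 1}" "Suc (b - 1) = b"
      using True by auto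
    ultimately show ?thesis
      unfolding Suc by simp
  qed (cases "a = b"; simp)
qed auto

context
  fixes V :: "'a set" and E p g
  assumes drawing: "plane_drawing V E p g"
begin

text \<open>A drawing fixes only the set of ends of \<open>g e\<close>; joining arcs along a walk
  needs a direction, obtained by reversing the arc if necessary.\<close>

lemma edge_arc:
  assumes "{u, v} \<in> E"
  obtains h where "arc h" "pathstart h = p u" "pathfinish h = p v" "path_image h = path_image (g {u, v})"
proof -
  have *: "arc (g {u, v})" "{pathstart (g {u, v}), pathfinish (g {u, v})} = {p u, p v}"
    using drawing assms unfolding plane_drawing_def by auto
  show thesis
  proof (cases "pathstart (g {u, v}) = p u")
    case True
    then have "pathfinish (g {u, v}) = p v"
      using * by (metis doubleton_eq_iff)
    then show thesis using that[of "g {u, v}"] * True by auto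
  next
    case False
    then have "pathstart (g {u, v}) = p v" "pathfinish (g {u, v}) = p u"
      using * by (auto simp: doubleton_eq_iff)
    then show thesis using that[of "reversepath (g {u, v})"] * by (auto simp: arc_reversepath)
  qed
qed

lemma vertex_in_edge_image: "e \<in> E \<Longrightarrow> u \<in> e \<Longrightarrow> p u \<in> path_image (g e)"
  using drawing unfolding plane_drawing_def
  by (metis image_eqI insertE pathfinish_in_path_image pathstart_in_path_image singletonD)

lemma edge_images_Int:
  "e \<in> E \<Longrightarrow> e' \<in> E \<Longrightarrow> e \<noteq> e' \<Longrightarrow> path_image (g e) \<inter> path_image (g e') \<subseteq> p ` (e \<inter> e')"
  using drawing unfolding plane_drawing_def by blast

definition walk_image :: "'a list \<Rightarrow> complex set" where
  "walk_image xs = (\<Union>e\<in>walk_edges xs. path_image (g e))"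

lemma vertex_in_walk_image:
  "walk_edges xs \<subseteq> E \<Longrightarrow> length xs \<ge> 2 \<Longrightarrow> x \<in> set xs \<Longrightarrow> p x \<in> walk_image xs"
  unfolding walk_image_def using walk_edges_cover[of xs x] vertex_in_edge_image by blast

lemma walk_images_Int:
  assumes "walk_edges xs \<subseteq> E" "walk_edges ys \<subseteq> E" "walk_edges xs \<inter> walk_edges ys = {}"
  shows "walk_image xs \<inter> walk_image ys \<subseteq> p ` (set xs \<inter> set ys)"
proof
  fix z assume "z \<in> walk_image xs \<inter> walk_image ys"
  then obtain e e' where e: "e \<in> walk_edges xs" "e' \<in> walk_edges ys"
    "z \<in> path_image (g e) \<inter> path_image (g e')"
    unfolding walk_image_def by blast
  then have "z \<in> p ` (e \<inter> e')"
    using edge_images_Int[of e e'] assms by blast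
  then show "z \<in> p ` (set xs \<inter> set ys)"
    using walk_edges_subset e by blast
qed

text \<open>Arcs are joined edge by edge. Distinctness keeps \<open>x\<close> out of the remaining
  walk, so the new arc meets the old one only at the drawn point of \<open>y\<close>.\<close>

lemma walk_arc:
  assumes "distinct xs" "length xs \<ge> 2" "walk_edges xs \<subseteq> E"
  shows "\<exists>h. arc h \<and> pathstart h = p (hd xs) \<and> pathfinish h = p (last xs) \<and> path_image h = walk_image xs"
  using assms
proof (induction xs rule: walk_edges.induct)
  case (1 x y zs)
  obtain h where h: "arc h" "pathstart h = p x" "pathfinish h = p y" "path_image h = walk_image [x, y]"
    using edge_arc[of x y] 1 by (auto simp: walk_image_def)
  show ?case
  proof (cases zs)
    case Nil
    then show ?thesis using h by auto
  next
    case (Cons z zs')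
    obtain h' where h': "arc h'" "pathstart h' = p y" "pathfinish h' = p (last (y # zs))"
        "path_image h' = walk_image (y # zs)"
      using 1 Cons by auto
    have "walk_edges [x, y] \<inter> walk_edges (y # zs) = {}"
      using walk_edges_subset[of "{x, y}" "y # zs"] 1 by auto
    then have "path_image h \<inter> path_image h' \<subseteq> {p y}"
      using walk_images_Int[of "[x, y]" "y # zs"] 1 h h' by auto
    then have "arc (h +++ h')"
      using h h' by (intro arc_join) auto
    moreover have "path_image (h +++ h') = walk_image (x # y # zs)"
      using h h' by (simp add: path_image_join walk_image_def)
    ultimately show ?thesis using h h' by (intro exI[of _ "h +++ h'"]) auto
  qed
qed auto

text \<open>A chord outside the cycle would, by the theta lemma, hide a vertex of one of the two walks
  from the outer face.\<close>

lemma outer_chord_inside: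
  assumes outer: "p ` V \<subseteq> frontier (outside (drawn_points V E p g))"
    and xs: "distinct xs" "length xs > 2" "walk_edges xs \<subseteq> E" "hd xs = u" "last xs = v" "set xs \<subseteq> V"
    and ys: "distinct ys" "length ys > 2" "walk_edges ys \<subseteq> E" "hd ys = u" "last ys = v" "set ys \<subseteq> V"
    and Int: "set xs \<inter> set ys = {u, v}"
    and uv: "{u, v} \<in> E" "{u, v} \<notin> walk_edges xs" "{u, v} \<notin> walk_edges ys"
  obtains \<alpha> \<beta> \<delta> where "arc \<alpha>" "pathstart \<alpha> = p u" "pathfinish \<alpha> = p v" "path_image \<alpha> = walk_image xs"
    "arc \<beta>" "pathstart \<beta> = p u" "pathfinish \<beta> = p v" "path_image \<beta> = walk_image ys"
    "arc \<delta>" "pathstart \<delta> = p u" "pathfinish \<delta> = p v" "path_image \<delta> = path_image (g {u, v})"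
    "path_image \<alpha> \<inter> path_image \<beta> = {p u, p v}" "path_image \<alpha> \<inter> path_image \<delta> = {p u, p v}"
    "path_image \<beta> \<inter> path_image \<delta> = {p u, p v}"
    "path_image \<delta> - {p u, p v} \<subseteq> inside (walk_image xs \<union> walk_image ys)"
proof -
  obtain \<alpha> where \<alpha>: "arc \<alpha>" "pathstart \<alpha> = p u" "pathfinish \<alpha> = p v" "path_image \<alpha> = walk_image xs"
    using walk_arc[of xs] xs by auto
  obtain \<beta> where \<beta>: "arc \<beta>" "pathstart \<beta> = p u" "pathfinish \<beta> = p v" "path_image \<beta> = walk_image ys"
    using walk_arc[of ys] ys by auto
  obtain \<delta> where \<delta>: "arc \<delta>" "pathstart \<delta> = p u" "pathfinish \<delta> = p v" "path_image \<delta> = path_image (g {u, v})"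
    using edge_arc uv by blast
  have \<delta>w: "path_image \<delta> = walk_image [u, v]"
    using \<delta> by (simp add: walk_image_def)
  have card2: "card e = 2" if "e \<in> walk_edges zs" "distinct zs" for e and zs :: "'a list"
    using that by (induction zs rule: walk_edges.induct) auto
  \<comment> \<open>The walks share only \<open>u\<close> and \<open>v\<close>, so a common edge
    could only be the chord itself, which belongs to neither walk.\<close>
  have "e = {u, v}" if "e \<in> walk_edges xs" "e \<in> walk_edges ys" for e
  proof -
    have "e \<subseteq> {u, v}" using that walk_edges_subset Int by blast
    moreover have "card e = 2" using that card2 xs by blast
    ultimately show ?thesis
      using card_seteq[of "{u, v}" e] by (simp add: card_insert_if)
  qed
  then have disj: "walk_edges xs \<inter> walk_edges ys = {}"
    using uv by blast
  have ends: "{p u, p v} \<subseteq> path_image h" if "pathstart h = p u" "pathfinish h = p v" for h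
    using that pathstart_in_path_image[of h] pathfinish_in_path_image[of h] by auto
  have uvin: "u \<in> set xs" "v \<in> set xs" "u \<in> set ys" "v \<in> set ys"
    using Int by blast+
  have \<alpha>\<beta>: "path_image \<alpha> \<inter> path_image \<beta> = {p u, p v}"
    using ends[OF \<alpha>(2,3)] ends[OF \<beta>(2,3)] walk_images_Int[of xs ys] xs ys Int disj \<alpha> \<beta> by auto
  have \<alpha>\<delta>: "path_image \<alpha> \<inter> path_image \<delta> = {p u, p v}"
    using ends[OF \<alpha>(2,3)] ends[OF \<delta>(2,3)] walk_images_Int[of xs "[u, v]"] xs uv \<alpha> \<delta>w by auto
  have \<beta>\<delta>: "path_image \<beta> \<inter> path_image \<delta> = {p u, p v}"
    using ends[OF \<beta>(2,3)] ends[OF \<delta>(2,3)] walk_images_Int[of ys "[u, v]"] ys uv \<beta> \<delta>w by auto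
  have inj: "inj_on p V" using drawing unfolding plane_drawing_def by blast
  \<comment> \<open>A third vertex of the walk would lie in an open region bounded by drawn points.
    Such a region misses the closure of the outer face, although all vertices lie on its
    frontier.\<close>
  have hidden: "\<not> path_image \<gamma> - {p u, p v} \<subseteq> inside (C \<union> path_image \<delta>)"
    if zs: "distinct zs" "length zs > 2" "walk_edges zs \<subseteq> E" "set zs \<subseteq> V" "path_image \<gamma> = walk_image zs"
      and uvz: "u \<in> set zs" "v \<in> set zs"
      and ws: "walk_edges ws \<subseteq> E" "C = walk_image ws" and clo: "closed (C \<union> path_image \<delta>)"
    for \<gamma> zs C ws
  proof
    assume sub: "path_image \<gamma> - {p u, p v} \<subseteq> inside (C \<union> path_image \<delta>)"
    have "\<not> set zs \<subseteq> {u, v}"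
      using zs card_mono[of "{u, v}" "set zs"] card_insert_le_m1[of 2 "{v}" u] distinct_card[of zs] by auto
    then obtain z where z: "z \<in> set zs" "z \<noteq> u" "z \<noteq> v" by blast
    have "p z \<noteq> p u" "p z \<noteq> p v"
      using inj z zs uvz by (auto dest: inj_onD)
    then have pz: "p z \<in> inside (C \<union> path_image \<delta>)"
      using sub vertex_in_walk_image[of zs z] zs z by auto
    have "C \<union> path_image \<delta> \<subseteq> drawn_points V E p g"
      using ws \<delta> uv unfolding drawn_points_def walk_image_def by auto
    then have "outside (drawn_points V E p g) \<subseteq> outside (C \<union> path_image \<delta>)"
      by (rule outside_mono)
    then have "inside (C \<union> path_image \<delta>) \<inter> outside (drawn_points V E p g) = {}"
      using inside_Int_outside by blast
    then have "inside (C \<union> path_image \<delta>) \<inter> closure (outside (drawn_points V E p g)) = {}"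
      using open_Int_closure_eq_empty open_inside clo by blast
    then show False
      using pz outer z zs unfolding frontier_def by blast
  qed
  have clo: "closed (walk_image xs \<union> path_image \<delta>)" "closed (walk_image ys \<union> path_image \<delta>)"
    using \<alpha> \<beta> \<delta> by (metis arc_imp_path closed_path_image closed_Un)+
  \<comment> \<open>A chord that missed the interior would, by \<open>theta_curve_inside\<close>,
    create one of the two configurations excluded by \<open>hidden\<close>.\<close>
  have ne: "path_image \<delta> \<inter> inside (path_image \<alpha> \<union> path_image \<beta>) \<noteq> {}"
    using theta_curve_inside[OF \<alpha>(1-3) \<beta>(1-3) \<delta>(1-3) \<alpha>\<beta> \<alpha>\<delta> \<beta>\<delta>]
      hidden[of xs \<alpha> ys "path_image \<beta>"] hidden[of ys \<beta> xs "path_image \<alpha>"] xs ys uvin \<alpha> \<beta> clo by auto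
  \<comment> \<open>Without its ends the chord is connected and avoids the cycle, which is the
    frontier of the interior; meeting the interior, it stays there.\<close>
  have "connected (path_image \<delta> - {p u, p v})"
    using connected_simple_path_endless[of \<delta>] \<delta> arc_imp_simple_path by auto
  moreover have "frontier (inside (path_image \<alpha> \<union> path_image \<beta>)) = path_image \<alpha> \<union> path_image \<beta>"
    using Jordan_two_arcs(4)[OF \<alpha>(1) \<beta>(1) \<alpha>(2,3) \<beta>(2,3) \<alpha>\<beta>] .
  moreover have "(path_image \<delta> - {p u, p v}) \<inter> inside (path_image \<alpha> \<union> path_image \<beta>) \<noteq> {}"
    using ne \<alpha>\<beta> inside_no_overlap[of "path_image \<alpha> \<union> path_image \<beta>"] by blast
  ultimately have "path_image \<delta> - {p u, p v} \<subseteq> inside (path_image \<alpha> \<union> path_image \<beta>)"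
    using connected_Int_frontier[of "path_image \<delta> - {p u, p v}" "inside (path_image \<alpha> \<union> path_image \<beta>)"] \<alpha>\<delta> \<beta>\<delta>
    by blast
  then show thesis
    using that \<alpha> \<beta> \<delta> \<alpha>\<beta> \<alpha>\<delta> \<beta>\<delta> by metis
qed

end

section \<open>Outerplanarity and interlacing edges\<close>

definition noncrossing :: "nat set set \<Rightarrow> bool" where
  "noncrossing E \<longleftrightarrow> (\<forall>a b c d. a < c \<longrightarrow> c < b \<longrightarrow> b < d \<longrightarrow> {a, b} \<in> E \<longrightarrow> {c, d} \<notin> E)"

lemma boundary_edges_image: "boundary_edges n = insert {0, n - 1} ((\<lambda>i. {i, Suc i}) ` {0..<n - 1})"
  unfolding boundary_edges_def by auto

text \<open>The cycle is cut at \<open>u\<close> and \<open>v\<close>. The second walk descends from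
  \<open>u\<close> to 0, steps to \<open>n - 1\<close> and descends to \<open>v\<close>, so that
  both walks run from \<open>u\<close> to \<open>v\<close>.\<close>

lemma boundary_split:
  assumes "u < v" "v < n"
  shows "walk_edges [u..<v + 1] \<union> walk_edges (rev [0..<u + 1] @ rev [v..<n]) = boundary_edges n"
proof -
  have 1: "walk_edges [u..<v + 1] = (\<lambda>i. {i, Suc i}) ` {u..<v}"
    by (subst walk_edges_upt) simp
  have 2: "walk_edges [0..<u + 1] = (\<lambda>i. {i, Suc i}) ` {0..<u}"
    by (subst walk_edges_upt) simp
  have "hd (rev [v..<n]) = n - 1" "last (rev [0..<u + 1]) = 0"
    using assms by (simp_all add: hd_rev last_rev last_upt del: upt_Suc)
  then have 3: "walk_edges (rev [0..<u + 1] @ rev [v..<n]) =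
      insert {0, n - 1} ((\<lambda>i. {i, Suc i}) ` {0..<u} \<union> (\<lambda>i. {i, Suc i}) ` {v..<n - 1})"
    using assms by (subst walk_edges_append) (simp_all add: walk_edges_rev walk_edges_upt 2 del: upt_Suc)
  have "{0..<n - 1} = {u..<v} \<union> ({0..<u} \<union> {v..<n - 1})"
    using assms by auto
  then show ?thesis
    unfolding 1 3 boundary_edges_image by (simp add: image_Un)
qed

text \<open>The gap conditions say that \<open>{u, v}\<close> is not a side of the polygon. Each of
  the two walks then has a vertex besides \<open>u\<close> and \<open>v\<close>, as the hiding
  argument requires.\<close>

lemma boundary_chord_inside:
  assumes drawing: "plane_drawing {..<n} E p g"
    and outer: "p ` {..<n} \<subseteq> frontier (outside (drawn_points {..<n} E p g))"
    and bnd: "boundary_edges n \<subseteq> E" and uv: "{u, v} \<in> E"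
    and gap: "u + 1 < v" "v < n" "v + 1 < n \<or> 0 < u"
  obtains \<alpha> \<beta> \<delta> where "arc \<alpha>" "pathstart \<alpha> = p u" "pathfinish \<alpha> = p v"
    "arc \<beta>" "pathstart \<beta> = p u" "pathfinish \<beta> = p v"
    "arc \<delta>" "pathstart \<delta> = p u" "pathfinish \<delta> = p v" "path_image \<delta> = path_image (g {u, v})"
    "path_image \<alpha> \<inter> path_image \<beta> = {p u, p v}" "path_image \<alpha> \<inter> path_image \<delta> = {p u, p v}"
    "path_image \<beta> \<inter> path_image \<delta> = {p u, p v}"
    "path_image \<delta> - {p u, p v} \<subseteq> inside (\<Union>e\<in>boundary_edges n. path_image (g e))"
    "p ` {u<..<v} \<subseteq> path_image \<alpha>" "p ` {v<..<n} \<subseteq> path_image \<beta>"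
    "path_image \<alpha> \<union> path_image \<beta> = (\<Union>e\<in>boundary_edges n. path_image (g e))"
proof -
  define xs ys where "xs = [u..<v + 1]" and "ys = rev [0..<u + 1] @ rev [v..<n]"
  note xs_def = this(1) and ys_def = this(2)
  have W: "walk_edges xs \<union> walk_edges ys = boundary_edges n"
    unfolding xs_def ys_def using boundary_split[of u v n] gap by simp
  have setx: "set xs = {u..v}" "length xs > 2" and sety: "set ys = {0..u} \<union> {v..<n}" "length ys > 2"
    using gap unfolding xs_def ys_def by auto
  have dist: "distinct xs" "distinct ys"
    using gap unfolding xs_def ys_def by (simp_all del: upt_Suc)
  have ends: "hd xs = u" "last xs = v" "hd ys = u" "last ys = v"
    using gap unfolding xs_def ys_def by (simp_all add: hd_rev last_rev)
  have sub: "walk_edges xs \<subseteq> E" "walk_edges ys \<subseteq> E"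
    using W bnd by blast+
  have "{u, v} \<notin> boundary_edges n"
    using gap unfolding boundary_edges_image by (auto simp: doubleton_eq_iff)
  then have nin: "{u, v} \<notin> walk_edges xs" "{u, v} \<notin> walk_edges ys"
    using W by blast+
  have ints: "set xs \<subseteq> {..<n}" "set ys \<subseteq> {..<n}" "set xs \<inter> set ys = {u, v}"
    unfolding setx sety using gap by auto
  have img: "walk_image g xs \<union> walk_image g ys = (\<Union>e\<in>boundary_edges n. path_image (g e))"
    unfolding walk_image_def[OF drawing] W[symmetric] by blast
  have px: "p ` {u<..<v} \<subseteq> walk_image g xs"
    using vertex_in_walk_image[OF drawing sub(1)] setx by auto
  have py: "p ` {v<..<n} \<subseteq> walk_image g ys"
    using vertex_in_walk_image[OF drawing sub(2)] sety by auto
  obtain \<alpha> \<beta> \<delta> where h: "arc \<alpha>" "pathstart \<alpha> = p u" "pathfinish \<alpha> = p v" "path_image \<alpha> = walk_image g xs"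
    "arc \<beta>" "pathstart \<beta> = p u" "pathfinish \<beta> = p v" "path_image \<beta> = walk_image g ys"
    "arc \<delta>" "pathstart \<delta> = p u" "pathfinish \<delta> = p v" "path_image \<delta> = path_image (g {u, v})"
    "path_image \<alpha> \<inter> path_image \<beta> = {p u, p v}" "path_image \<alpha> \<inter> path_image \<delta> = {p u, p v}"
    "path_image \<beta> \<inter> path_image \<delta> = {p u, p v}"
    "path_image \<delta> - {p u, p v} \<subseteq> inside (walk_image g xs \<union> walk_image g ys)"
    by (rule outer_chord_inside[OF drawing outer dist(1) setx(2) sub(1) ends(1,2) ints(1)
          dist(2) sety(2) sub(2) ends(3,4) ints(2,3) uv nin])
  show thesis
    by (rule that[OF h(1-3) h(5-7) h(9-12) h(13-15) h(16)[unfolded img]])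
      (simp_all only: h(4,8) px py img)
qed

theorem outerplanar_imp_noncrossing:
  assumes "outerplanar {..<n} E" "boundary_edges n \<subseteq> E"
  shows "noncrossing E"
  unfolding noncrossing_def
proof (intro allI impI notI)
  fix u v x y assume ord: "u < x" "x < v" "v < y" and E: "{u, v} \<in> E" "{x, y} \<in> E"
  obtain p g where drawing: "plane_drawing {..<n} E p g"
    and outer: "p ` {..<n} \<subseteq> frontier (outside (drawn_points {..<n} E p g))"
    using assms(1) unfolding outerplanar_def by blast
  have "y < n"
    using assms(1) E(2) unfolding outerplanar_def simple_graph_def by blast
  \<comment> \<open>Interlaced edges are never sides: \<open>x\<close> lies strictly between
    \<open>u\<close> and \<open>v\<close>, \<open>v\<close> strictly between \<open>x\<close> and
    \<open>y\<close>, and \<open>y\<close>, respectively \<open>u\<close>, lies beyond.\<close>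
  have gap1: "u + 1 < v" "v < n" "v + 1 < n \<or> 0 < u" and gap2: "x + 1 < y" "y < n" "y + 1 < n \<or> 0 < x"
    using ord \<open>y < n\<close> by linarith+
  let ?C = "\<Union>e\<in>boundary_edges n. path_image (g e)"
  obtain \<alpha> \<beta> \<delta> where \<alpha>: "arc \<alpha>" "pathstart \<alpha> = p u" "pathfinish \<alpha> = p v"
    and \<beta>: "arc \<beta>" "pathstart \<beta> = p u" "pathfinish \<beta> = p v"
    and \<delta>: "arc \<delta>" "pathstart \<delta> = p u" "pathfinish \<delta> = p v" "path_image \<delta> = path_image (g {u, v})"
    and ints: "path_image \<alpha> \<inter> path_image \<beta> = {p u, p v}" "path_image \<alpha> \<inter> path_image \<delta> = {p u, p v}"
      "path_image \<beta> \<inter> path_image \<delta> = {p u, p v}"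
    and in\<delta>: "path_image \<delta> - {p u, p v} \<subseteq> inside ?C"
    and on: "p ` {u<..<v} \<subseteq> path_image \<alpha>" "p ` {v<..<n} \<subseteq> path_image \<beta>"
    and C: "path_image \<alpha> \<union> path_image \<beta> = ?C"
    by (rule boundary_chord_inside[OF drawing outer assms(2) E(1) gap1])
  obtain \<epsilon> where \<epsilon>: "arc \<epsilon>" "pathstart \<epsilon> = p x" "pathfinish \<epsilon> = p y" "path_image \<epsilon> = path_image (g {x, y})"
    and in\<epsilon>: "path_image \<epsilon> - {p x, p y} \<subseteq> inside ?C"
    by (rule boundary_chord_inside[OF drawing outer assms(2) E(2) gap2]) blast
  have inj: "inj_on p {..<n}" using drawing unfolding plane_drawing_def by blast
  have xyne: "p x \<noteq> p u" "p x \<noteq> p v" "p y \<noteq> p u" "p y \<noteq> p v"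
    using inj ord \<open>y < n\<close> by (auto dest!: inj_onD)
  have xyin: "p x \<in> path_image \<alpha>" "p y \<in> path_image \<beta>"
    using on ord \<open>y < n\<close> by auto
  have "path_image \<delta> - {p u, p v} \<noteq> {}"
    using nonempty_simple_path_endless[OF arc_imp_simple_path[OF \<delta>(1)]] \<delta>(2,3) by metis
  then have ne: "path_image \<delta> \<inter> inside (path_image \<alpha> \<union> path_image \<beta>) \<noteq> {}"
    using in\<delta> unfolding C by blast
  have "path_image \<delta> \<inter> path_image \<epsilon> \<noteq> {}"
    by (rule chords_inside_not_disjoint[OF \<alpha>(1-3) \<beta>(1-3) \<delta>(1-3) ints ne \<epsilon>(1)])
      (use \<epsilon>(2,3) xyin xyne in\<epsilon> C in simp_all)
  moreover have "{u, v} \<noteq> {x, y}" "{u, v} \<inter> {x, y} = {}"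
    using ord by (auto simp: doubleton_eq_iff)
  then have "path_image \<delta> \<inter> path_image \<epsilon> \<subseteq> {}"
    using edge_images_Int[OF drawing E] unfolding \<delta>(4) \<epsilon>(4) by simp
  ultimately show False by simp
qed

lemma noncrossing_subset: "noncrossing E \<Longrightarrow> F \<subseteq> E \<Longrightarrow> noncrossing F"
  unfolding noncrossing_def by blast

section \<open>Straight-line drawings on a parabola\<close>

definition parabola :: "nat \<Rightarrow> complex" where
  "parabola v = Complex (real v) ((real v)\<^sup>2)"

text \<open>The sign of this affine function tells on which side of the chord \<open>ab\<close> a point lies.\<close>

definition chord_side :: "nat \<Rightarrow> nat \<Rightarrow> complex \<Rightarrow> real" where
  "chord_side a b z = Im z - (real a + real b) * Re z + real a * real b"

text \<open>The factorization makes the order of labels visible as sign: vertices strictly between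
  \<open>a\<close> and \<open>b\<close> are on the negative side, those outside on the positive
  side, and only the ends give 0.\<close>

lemma chord_side_parabola: "chord_side a b (parabola t) = (real t - real a) * (real t - real b)"
  by (simp add: chord_side_def parabola_def power2_eq_square algebra_simps)

lemma chord_side_convex:
  "chord_side a b ((1 - t) *\<^sub>R z + t *\<^sub>R w) = (1 - t) * chord_side a b z + t * chord_side a b w"
  by (simp add: chord_side_def algebra_simps)

lemma chord_side_segment:
  assumes "z \<in> closed_segment (parabola a) (parabola b)"
  shows "chord_side a b z = 0"
proof -
  obtain t where "z = (1 - t) *\<^sub>R parabola a + t *\<^sub>R parabola b"
    using assms by (auto simp: in_segment)
  then show ?thesis by (simp add: chord_side_convex chord_side_parabola)
qed

lemma parabola_eq_iff [simp]: "parabola a = parabola b \<longleftrightarrow> a = b"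
  by (auto simp: parabola_def)

text \<open>Without interlacing, \<open>c\<close> and \<open>d\<close> are not strictly on opposite
  sides of the line through \<open>a\<close> and \<open>b\<close>. A point of \<open>cd\<close> on
  that line is a convex combination with value 0 of two values of equal sign, so both terms vanish.
  As the two edges differ, the point must be an end of \<open>cd\<close> that is also an end of
  \<open>ab\<close>.\<close>

lemma noncrossing_segments:
  assumes ne: "{a, b} \<noteq> {c, d}" and lt: "a < b" "c < d"
    and nc: "\<not> (a < c \<and> c < b \<and> b < d)" "\<not> (c < a \<and> a < d \<and> d < b)"
  shows "closed_segment (parabola a) (parabola b) \<inter> closed_segment (parabola c) (parabola d)
    \<subseteq> parabola ` ({a, b} \<inter> {c, d})"
proof
  fix z assume z: "z \<in> closed_segment (parabola a) (parabola b) \<inter> closed_segment (parabola c) (parabola d)"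
  let ?l = "chord_side a b"
  define L M where "L = ?l (parabola c)" and "M = ?l (parabola d)"
  obtain t where t: "0 \<le> t" "t \<le> 1" "z = (1 - t) *\<^sub>R parabola c + t *\<^sub>R parabola d"
    using z by (auto simp: in_segment)
  have "?l z = 0" using z chord_side_segment by blast
  then have eq: "(1 - t) * L + t * M = 0"
    unfolding L_def M_def t(3) by (simp add: chord_side_convex)
  have zero: "L = 0 \<longleftrightarrow> c \<in> {a, b}" "M = 0 \<longleftrightarrow> d \<in> {a, b}"
    by (auto simp: L_def M_def chord_side_parabola)
  have "(L \<ge> 0 \<and> M \<ge> 0) \<or> (L \<le> 0 \<and> M \<le> 0)"
    using lt nc unfolding L_def M_def chord_side_parabola
    by (auto simp: zero_le_mult_iff mult_le_0_iff)
  moreover have "0 \<le> (1 - t) * L" "0 \<le> t * M" if "L \<ge> 0" "M \<ge> 0"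
    using that t by simp_all
  moreover have "(1 - t) * L \<le> 0" "t * M \<le> 0" if "L \<le> 0" "M \<le> 0"
    using that t by (simp_all add: mult_nonneg_nonpos)
  ultimately have "(1 - t) * L = 0" "t * M = 0"
    using eq by linarith+
  then have "(t = 1 \<or> c \<in> {a, b}) \<and> (t = 0 \<or> d \<in> {a, b})"
    using zero by auto
  moreover have "\<not> (c \<in> {a, b} \<and> d \<in> {a, b})"
    using ne lt by auto
  ultimately consider "t = 1" "d \<in> {a, b}" | "t = 0" "c \<in> {a, b}"
    by auto
  then show "z \<in> parabola ` ({a, b} \<inter> {c, d})"
  proof cases
    case 1
    then have "z = parabola d" using t(3) by simp
    then show ?thesis using 1 by simp
  next
    case 2
    then have "z = parabola c" using t(3) by simp
    then show ?thesis using 2 by simp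
  qed
qed

theorem noncrossing_imp_outerplanar:
  assumes simple: "simple_graph {..<n} E" and nc: "noncrossing E"
  shows "outerplanar {..<n} E"
proof -
  define g where "g e = linepath (parabola (Min e)) (parabola (Max e))" for e
  have edge: "\<exists>a b. a < b \<and> e = {a, b} \<and> g e = linepath (parabola a) (parabola b)" if "e \<in> E" for e
  proof -
    have "card e = 2" using that simple unfolding simple_graph_def by blast
    then obtain x y where "e = {x, y}" "x \<noteq> y" by (auto simp: card_2_iff)
    then have "e = {min x y, max x y}" "min x y < max x y" by (auto simp: min_def max_def)
    moreover have "Min e = min x y" "Max e = max x y" using \<open>e = {x, y}\<close> by simp_all
    ultimately show ?thesis unfolding g_def by metis
  qed
  have drawing: "plane_drawing {..<n} E parabola g"
    unfolding plane_drawing_def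
  proof (intro conjI ballI impI)
    show "inj_on parabola {..<n}" by (simp add: inj_on_def)
  next
    fix e assume "e \<in> E"
    then obtain a b where e: "a < b" "e = {a, b}" "g e = linepath (parabola a) (parabola b)"
      using edge by blast
    show "arc (g e)" "{pathstart (g e), pathfinish (g e)} = parabola ` e"
      using e by simp_all
    show "path_image (g e) \<inter> parabola ` {..<n} \<subseteq> parabola ` e"
    proof
      fix z assume "z \<in> path_image (g e) \<inter> parabola ` {..<n}"
      then obtain v where v: "z = parabola v" "z \<in> closed_segment (parabola a) (parabola b)"
        using e by auto
      then have "(real v - real a) * (real v - real b) = 0"
        using chord_side_segment chord_side_parabola by metis
      then show "z \<in> parabola ` e" using e v by auto
    qed
  next
    fix e f assume "e \<in> E" "f \<in> E" and ne: "e \<noteq> f"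
    obtain a b where e: "a < b" "e = {a, b}" "g e = linepath (parabola a) (parabola b)"
      using edge \<open>e \<in> E\<close> by blast
    obtain c d where f: "c < d" "f = {c, d}" "g f = linepath (parabola c) (parabola d)"
      using edge \<open>f \<in> E\<close> by blast
    show "path_image (g e) \<inter> path_image (g f) \<subseteq> parabola ` (e \<inter> f)"
      unfolding e(3) f(3) path_image_linepath unfolding e(2) f(2)
    proof (rule noncrossing_segments)
      show "\<not> (a < c \<and> c < b \<and> b < d)" "\<not> (c < a \<and> a < d \<and> d < b)"
        using nc \<open>e \<in> E\<close> \<open>f \<in> E\<close> unfolding e(2) f(2) noncrossing_def by blast+
    qed (use ne e f in auto)
  qed
  \<comment> \<open>\<open>?T\<close> is the region on or above the parabola. Its convexity confines
    all straight edges to it, and the complement of a convex set containing the drawing belongs to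
    the outer face.\<close>
  let ?T = "{z. (Re z)\<^sup>2 \<le> Im z}" and ?S = "drawn_points {..<n} E parabola g"
  have conv: "convex ?T"
  proof (rule convexI)
    fix z w :: complex and s t :: real
    assume "z \<in> ?T" "w \<in> ?T" and st: "0 \<le> s" "0 \<le> t" "s + t = 1"
    then have "s * (Re z)\<^sup>2 + t * (Re w)\<^sup>2 \<le> s * Im z + t * Im w"
      by (intro add_mono mult_left_mono) auto
    moreover have "(s * Re z + t * Re w)\<^sup>2 \<le> s * (Re z)\<^sup>2 + t * (Re w)\<^sup>2"
    proof -
      have s: "s = 1 - t" using st by simp
      show ?thesis using convex_onD[OF convex_power2, of t "Re z" "Re w"] st(1,2) unfolding s by simp
    qed
    ultimately show "s *\<^sub>R z + t *\<^sub>R w \<in> ?T" by simp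
  qed
  have on: "parabola v \<in> ?T" for v by (simp add: parabola_def)
  have "path_image (g e) \<subseteq> ?T" if e: "e \<in> E" for e
  proof -
    obtain a b where "g e = linepath (parabola a) (parabola b)" using edge[OF e] by blast
    then show ?thesis using closed_segment_subset[OF on on conv] by simp
  qed
  then have "?S \<subseteq> ?T"
    using on unfolding drawn_points_def by blast
  then have out: "- ?T \<subseteq> outside ?S"
    by (rule outside_subset_convex[OF conv])
  have "parabola v \<in> frontier (outside ?S)" if "v < n" for v
  proof -
    have "\<exists>y\<in>outside ?S. dist y (parabola v) < e" if "e > 0" for e
    proof
      \<comment> \<open>A point slightly below the vertex has already left
        \<open>?T\<close>.\<close>
      let ?y = "parabola v - Complex 0 (e / 2)"
      have "?y \<in> - ?T" using that by (simp add: parabola_def)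
      then show "?y \<in> outside ?S" using out by (rule rev_subsetD)
      show "dist ?y (parabola v) < e" using that by (simp add: dist_norm cmod_def)
    qed
    then have "parabola v \<in> closure (outside ?S)" by (simp add: closure_approachable)
    moreover have "parabola v \<in> ?S" using that unfolding drawn_points_def by simp
    then have "parabola v \<notin> outside ?S" using outside_no_overlap[of ?S] by blast
    then have "parabola v \<notin> interior (outside ?S)" using interior_subset[of "outside ?S"] by blast
    ultimately show ?thesis unfolding frontier_def by (rule DiffI)
  qed
  then show ?thesis
    unfolding outerplanar_def using simple drawing by blast
qed

text \<open>The claim is made for intervals of labels because the induction cuts
  \<open>{a..b}\<close> at a vertex \<open>m\<close> such that every edge except possibly
  \<open>{a, b}\<close> stays on one side. The bound is additive: one for \<open>{a, b}\<close>
  makes up exactly for the second \<open>- 1\<close>.\<close>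

lemma noncrossing_card_le:
  assumes "a < b" "noncrossing E" "\<And>e. e \<in> E \<Longrightarrow> e \<subseteq> {a..b} \<and> card e = 2"
  shows "finite E \<and> card E \<le> 2 * (b - a) - 1"
  using assms
proof (induction "b - a" arbitrary: a b E rule: less_induct)
  case less
  have fin: "finite E"
    using less.prems by (intro finite_subset[of E "Pow {a..b}"]) auto
  have pair: "\<exists>x y. x < y \<and> a \<le> x \<and> y \<le> b \<and> e = {x, y}" if e: "e \<in> E" for e
  proof -
    obtain x y where "e = {x, y}" "x \<noteq> y" using less.prems(3)[OF e] by (auto simp: card_2_iff)
    then have "e = {min x y, max x y}" "min x y < max x y" by (auto simp: min_def max_def)
    moreover have "a \<le> min x y" "max x y \<le> b" using less.prems(3)[OF e] \<open>e = {x, y}\<close> by auto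
    ultimately show ?thesis by blast
  qed
  show ?case
  proof (cases "b = Suc a")
    case True
    have "E \<subseteq> {{a, b}}" using pair True by fastforce
    then have "card E \<le> 1" using card_mono[of "{{a, b}}" E] by simp
    then show ?thesis using fin True by simp
  next
    case False
    \<comment> \<open>The cut is at the largest neighbour of \<open>a\<close> below
      \<open>b\<close>. An edge \<open>{x, y}\<close> spanning \<open>m\<close> and starting at
      \<open>a\<close> must end at \<open>b\<close> by maximality; one starting later would
      interlace \<open>{a, m}\<close>. Without such a neighbour, \<open>Suc a\<close> works since
      only \<open>a\<close> precedes it.\<close>
    define N where "N = {m. a < m \<and> m < b \<and> {a, m} \<in> E}"
    define m where "m = (if N = {} then Suc a else Max N)"
    have finN: "finite N" unfolding N_def by simp
    have "N \<noteq> {} \<Longrightarrow> m \<in> N" using finN m_def by simp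
    then have m: "a < m" "m < b" "N \<noteq> {} \<Longrightarrow> {a, m} \<in> E"
      using False less.prems(1) by (cases "N = {}"; auto simp: m_def N_def)+
    have Nle: "x \<le> m" if "x \<in> N" for x using that finN by (auto simp: m_def)
    let ?L = "{e \<in> E. e \<subseteq> {a..m}}" and ?R = "{e \<in> E. e \<subseteq> {m..b}}"
    have "E \<subseteq> insert {a, b} (?L \<union> ?R)"
    proof
      fix e assume e: "e \<in> E"
      obtain x y where xy: "x < y" "a \<le> x" "y \<le> b" "e = {x, y}" using pair[OF e] by blast
      show "e \<in> insert {a, b} (?L \<union> ?R)"
      proof (cases "x < m \<and> m < y")
        case True
        then have "y = b" if "x = a" using that xy e Nle[of y] by (cases "y < b") (auto simp: N_def)
        moreover have "x = a"
        proof (rule ccontr)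
          assume "x \<noteq> a"
          then have "N \<noteq> {}" using True xy by (auto simp: m_def split: if_splits)
          then show False
            using m \<open>x \<noteq> a\<close> xy True less.prems(2) e unfolding noncrossing_def
            by (metis le_neq_implies_less)
        qed
        ultimately show ?thesis using xy by simp
      next
        case False
        then show ?thesis using xy e by auto
      qed
    qed
    then have "card E \<le> card (insert {a, b} (?L \<union> ?R))"
      using fin by (intro card_mono) auto
    also have "\<dots> \<le> 1 + (card ?L + card ?R)"
      using card_Un_le[of "{{a, b}}" "?L \<union> ?R"] card_Un_le[of ?L ?R] by simp
    finally have "card E \<le> 1 + (card ?L + card ?R)" .
    moreover have "card ?L \<le> 2 * (m - a) - 1"
    proof (rule conjunct2[OF less.hyps])
      show "noncrossing ?L" using less.prems(2) by (rule noncrossing_subset) blast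
    qed (use less.prems m in auto)
    moreover have "card ?R \<le> 2 * (b - m) - 1"
    proof (rule conjunct2[OF less.hyps])
      show "noncrossing ?R" using less.prems(2) by (rule noncrossing_subset) blast
    qed (use less.prems m in auto)
    moreover have "1 + ((2 * (m - a) - 1) + (2 * (b - m) - 1)) \<le> 2 * (b - a) - 1"
      using m by linarith
    ultimately have "card E \<le> 2 * (b - a) - 1" by linarith
    then show ?thesis using fin by simp
  qed
qed

theorem triangulation_maximal_outerplanar:
  assumes "n \<ge> 2" and simple: "simple_graph {..<n} E" and nc: "noncrossing E"
    and bnd: "boundary_edges n \<subseteq> E" and card: "card E \<ge> 2 * n - 3"
  shows "maximal_outerplanar {..<n} E"
  unfolding maximal_outerplanar_def
proof (intro conjI ballI impI notI)
  show "outerplanar {..<n} E" using simple nc by (rule noncrossing_imp_outerplanar)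
next
  fix u v assume uv: "u \<in> {..<n}" "v \<in> {..<n}" "u \<noteq> v \<and> {u, v} \<notin> E"
    and op: "outerplanar {..<n} (insert {u, v} E)"
  let ?E = "insert {u, v} E"
  have "noncrossing ?E"
    using op bnd by (intro outerplanar_imp_noncrossing) auto
  moreover have "e \<subseteq> {0..n - 1} \<and> card e = 2" if "e \<in> ?E" for e
    using op that \<open>n \<ge> 2\<close> unfolding outerplanar_def simple_graph_def by fastforce
  ultimately have "finite ?E" "card ?E \<le> 2 * (n - 1) - 1"
    using noncrossing_card_le[of 0 "n - 1" ?E] \<open>n \<ge> 2\<close> by auto
  then show False using uv card \<open>n \<ge> 2\<close> by simp
qed

section \<open>Interlacing and degrees under gluing\<close>

text \<open>If an edge of \<open>E\<close> interlaced one of \<open>F\<close>, an end of the latter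
  would lie strictly between the ends of the former, hence strictly between \<open>s\<close> and
  \<open>t\<close>.\<close>

lemma noncrossing_glue:
  assumes "noncrossing E" "\<And>e. e \<in> E \<Longrightarrow> e \<subseteq> {s..t}"
    and "noncrossing F" "\<And>f. f \<in> F \<Longrightarrow> f \<subseteq> {..s} \<union> {t..}"
  shows "noncrossing (E \<union> F)"
  unfolding noncrossing_def
proof (intro allI impI notI)
  fix a b c d assume ord: "a < c" "c < b" "b < d" and mem: "{a, b} \<in> E \<union> F" "{c, d} \<in> E \<union> F"
  have E: "s \<le> x \<and> y \<le> t \<and> s \<le> y \<and> x \<le> t" if "{x, y} \<in> E" for x y
    using assms(2)[OF that] by auto
  have F: "(x \<le> s \<or> t \<le> x) \<and> (y \<le> s \<or> t \<le> y)" if "{x, y} \<in> F" for x y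
    using assms(4)[OF that] by auto
  consider "{a, b} \<in> E" "{c, d} \<in> E" | "{a, b} \<in> F" "{c, d} \<in> F"
    | "{a, b} \<in> E" "{c, d} \<in> F" | "{a, b} \<in> F" "{c, d} \<in> E"
    using mem by blast
  then show False
  proof cases
    case 1
    then show False using assms(1) ord unfolding noncrossing_def by blast
  next
    case 2
    then show False using assms(3) ord unfolding noncrossing_def by blast
  next
    case 3
    then show False using E[OF 3(1)] F[OF 3(2)] ord by linarith
  next
    case 4
    then show False using F[OF 4(1)] E[OF 4(2)] ord by linarith
  qed
qed

lemma noncrossing_image:
  assumes "strict_mono f" "noncrossing E"
  shows "noncrossing ((`) f ` E)"
  unfolding noncrossing_def
proof (intro allI impI notI)
  fix a b c d assume ord: "a < c" "c < b" "b < d" and mem: "{a, b} \<in> (`) f ` E" "{c, d} \<in> (`) f ` E"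
  have inj: "inj f" using assms(1) by (rule strict_mono_imp_inj_on)
  have pre: "\<exists>x' y'. x = f x' \<and> y = f y' \<and> {x', y'} \<in> E" if xy: "{x, y} \<in> (`) f ` E" for x y
  proof -
    obtain e where e: "e \<in> E" "{x, y} = f ` e" using xy by blast
    have "x \<in> f ` e" "y \<in> f ` e" using e(2) by blast+
    then obtain x' y' where p: "x = f x'" "y = f y'" by blast
    then have "f ` e = f ` {x', y'}" using e(2) by simp
    then have "e = {x', y'}" using inj by (simp only: inj_image_eq_iff)
    then show ?thesis using e(1) p by blast
  qed
  obtain a' b' c' d' where "a = f a'" "b = f b'" "{a', b'} \<in> E" "c = f c'" "d = f d'" "{c', d'} \<in> E"
    using pre[OF mem(1)] pre[OF mem(2)] by blast
  then show False
    using ord assms(2) unfolding noncrossing_def by (metis assms(1) strict_mono_less)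
qed

lemma degree_Un:
  assumes "finite E" "finite F" "E \<inter> F = {}"
  shows "degree (E \<union> F) v = degree E v + degree F v"
proof -
  have "{e \<in> E \<union> F. v \<in> e} = {e \<in> E. v \<in> e} \<union> {e \<in> F. v \<in> e}" by blast
  then show ?thesis
    unfolding degree_def using assms by (subst card_Un_disjoint[symmetric]) auto
qed

lemma degree_image:
  assumes "inj f"
  shows "degree ((`) f ` E) (f v) = degree E v"
proof -
  have "{e \<in> (`) f ` E. f v \<in> e} = (`) f ` {e \<in> E. v \<in> e}"
  proof -
    have "f v \<in> f ` e \<longleftrightarrow> v \<in> e" for e using assms by (rule inj_image_mem_iff)
    then show ?thesis by auto
  qed
  moreover have "inj_on ((`) f) {e \<in> E. v \<in> e}"
    using assms by (auto simp: inj_on_def inj_image_eq_iff)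
  ultimately show ?thesis
    unfolding degree_def by (simp add: card_image)
qed

lemma degree_outside:
  assumes "\<And>e. e \<in> E \<Longrightarrow> v \<notin> e"
  shows "degree E v = 0"
proof -
  have "{e \<in> E. v \<in> e} = {}" using assms by blast
  then show ?thesis unfolding degree_def by (simp only: card.empty)
qed

section \<open>Explicit finite pieces, checked by evaluation\<close>

definition pair_edges :: "(nat \<times> nat) list \<Rightarrow> nat set set" where
  "pair_edges ps = (\<lambda>(a, b). {a, b}) ` set ps"

lemma finite_pair_edges [simp]: "finite (pair_edges ps)"
  by (simp add: pair_edges_def)

context
  fixes ps :: "(nat \<times> nat) list"
  assumes ordered: "\<forall>(a, b)\<in>set ps. a < b"
begin

lemma orderedD: "(a, b) \<in> set ps \<Longrightarrow> a < b"
  using ordered by blast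

text \<open>Listing the smaller end first excludes having both (a, b) and (b, a), so counting edges
  reduces to counting list entries.\<close>

lemma inj_pair_edges: "inj_on (\<lambda>(a, b). {a, b}) (set ps)"
  unfolding inj_on_def by (auto simp: doubleton_eq_iff dest!: orderedD)

lemma card_in_pair_edges: "e \<in> pair_edges ps \<Longrightarrow> card e = 2"
  by (auto simp: pair_edges_def dest: orderedD)

lemma card_pair_edges: "distinct ps \<Longrightarrow> card (pair_edges ps) = length ps"
  unfolding pair_edges_def by (simp add: card_image inj_pair_edges distinct_card)

lemma degree_pair_edges:
  assumes "distinct ps"
  shows "degree (pair_edges ps) v = length (filter (\<lambda>(a, b). v = a \<or> v = b) ps)"
proof -
  have "{e \<in> pair_edges ps. v \<in> e} = (\<lambda>(a, b). {a, b}) ` set (filter (\<lambda>(a, b). v = a \<or> v = b) ps)"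
    unfolding pair_edges_def by auto
  moreover have "inj_on (\<lambda>(a, b). {a, b}) (set (filter (\<lambda>(a, b). v = a \<or> v = b) ps))"
    by (rule inj_on_subset[OF inj_pair_edges]) auto
  ultimately have "degree (pair_edges ps) v = card (set (filter (\<lambda>(a, b). v = a \<or> v = b) ps))"
    unfolding degree_def by (simp add: card_image)
  then show ?thesis using assms by (simp only: distinct_card distinct_filter)
qed

lemma noncrossing_pair_edges:
  assumes "\<forall>(a, b)\<in>set ps. \<forall>(c, d)\<in>set ps. \<not> (a < c \<and> c < b \<and> b < d)"
  shows "noncrossing (pair_edges ps)"
  unfolding noncrossing_def
proof (intro allI impI notI)
  fix a b c d assume ord: "a < c" "c < b" "b < d" and mem: "{a, b} \<in> pair_edges ps" "{c, d} \<in> pair_edges ps"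
  have "(x, y) \<in> set ps" if "{x, y} \<in> pair_edges ps" "x < y" for x y
    using that by (fastforce simp: pair_edges_def doubleton_eq_iff dest: orderedD)
  then have "(a, b) \<in> set ps" "(c, d) \<in> set ps" using mem ord by auto
  then show False using assms ord by blast
qed

end

text \<open>A block in its local labels: 17 chords, the outer rung (0, 19) and 18 sides. The inner
  rung (9, 10) is left out since the enclosed ladder already supplies it; 36 of the 37 edges of a
  triangulated 20-gon remain.\<close>

definition layer_pairs :: "(nat \<times> nat) list" where
  "layer_pairs =
     [(0, 2), (2, 4), (4, 6), (6, 8), (0, 11), (0, 13), (0, 15), (0, 17), (2, 11), (4, 11), (6, 11), (8, 11),
      (11, 13), (13, 15), (15, 17), (17, 19), (8, 10), (0, 19),
      (0, 1), (1, 2), (2, 3), (3, 4), (4, 5), (5, 6), (6, 7), (7, 8), (8, 9),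
      (10, 11), (11, 12), (12, 13), (13, 14), (14, 15), (15, 16), (16, 17), (17, 18), (18, 19)]"

text \<open>The innermost part, a triangulated 18-gon: the 15 chords of \<open>H_Gamma\<close>, the
  last rung (0, 17) and 17 sides.\<close>

definition core_pairs :: "(nat \<times> nat) list" where
  "core_pairs =
     [(0, 13), (0, 15), (1, 3), (1, 12), (1, 13), (3, 5), (3, 10), (3, 12), (5, 7), (5, 10), (7, 9), (7, 10),
      (10, 12), (13, 15), (15, 17), (0, 17),
      (0, 1), (1, 2), (2, 3), (3, 4), (4, 5), (5, 6), (6, 7), (7, 8), (8, 9), (9, 10),
      (10, 11), (11, 12), (12, 13), (13, 14), (14, 15), (15, 16), (16, 17)]"

text \<open>Labels 0, 1, 2, 3 stand for the vertices 0, n-3, n-2, n-1. These are two triangles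
  without the rung (0, 1), which belongs to the ladder.\<close>

definition cap_pairs :: "(nat \<times> nat) list" where
  "cap_pairs = [(1, 2), (2, 3), (0, 3), (1, 3)]"

lemma ordered_pairs:
  "\<forall>(a, b)\<in>set layer_pairs. a < b" "\<forall>(a, b)\<in>set core_pairs. a < b" "\<forall>(a, b)\<in>set cap_pairs. a < b"
  by code_simp+

lemma distinct_pairs: "distinct layer_pairs" "distinct core_pairs" "distinct cap_pairs"
  by code_simp+

lemma noncrossing_pairs:
  "noncrossing (pair_edges layer_pairs)" "noncrossing (pair_edges core_pairs)" "noncrossing (pair_edges cap_pairs)"
  by (rule noncrossing_pair_edges, rule ordered_pairs, code_simp)+

lemma degrees_pairs:
  "map (degree (pair_edges layer_pairs)) [0..<20] = [7, 2, 5, 2, 5, 2, 5, 2, 5, 1, 2, 8, 2, 5, 2, 5, 2, 5, 2, 3]"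
  "map (degree (pair_edges core_pairs)) [0..<18] = [4, 5, 2, 6, 2, 5, 2, 5, 2, 3, 6, 2, 5, 5, 2, 5, 2, 3]"
  "map (degree (pair_edges cap_pairs)) [0..<4] = [1, 2, 2, 3]"
  unfolding degree_pair_edges[OF ordered_pairs(1) distinct_pairs(1)]
    degree_pair_edges[OF ordered_pairs(2) distinct_pairs(2)]
    degree_pair_edges[OF ordered_pairs(3) distinct_pairs(3)]
  by code_simp+

section \<open>The ladder, built layer by layer from the inside\<close>

definition layer_pos :: "nat \<Rightarrow> nat \<Rightarrow> nat" where
  "layer_pos k l = (if l \<le> 9 then l else l + 18 * k + 16)"

definition cap_pos :: "nat \<Rightarrow> nat \<Rightarrow> nat" where
  "cap_pos k l = (if l = 0 then 0 else l + 18 * k + 16)"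

lemma strict_mono_pos: "strict_mono (layer_pos k)" "strict_mono (cap_pos k)"
  by (simp_all add: strict_mono_def layer_pos_def cap_pos_def)

text \<open>Blocks are numbered from the outside, so a new layer is block 0 and the old ladder moves
  to the labels from 9 to 18k+26. Label 10 of the layer has to fall on that last vertex, whence the
  offset 18k+16 in \<open>layer_pos\<close>. The core alone belongs to the graph with parameter 1,
  so \<open>ladder k\<close> serves parameter k+1.\<close>

primrec ladder :: "nat \<Rightarrow> nat set set" where
  "ladder 0 = pair_edges core_pairs"
| "ladder (Suc k) = (`) ((+) 9) ` ladder k \<union> (`) (layer_pos k) ` pair_edges layer_pairs"

lemma ladder_edge: "e \<in> ladder k \<Longrightarrow> e \<subseteq> {0..18 * k + 17} \<and> card e = 2"
proof (induction k arbitrary: e)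
  case 0
  then have "e \<in> pair_edges core_pairs" by simp
  moreover have "\<forall>(a, b)\<in>set core_pairs. a \<le> 17 \<and> b \<le> 17" by code_simp
  ultimately have "e \<subseteq> {0..17}" by (force simp: pair_edges_def)
  then show ?case
    using card_in_pair_edges[OF ordered_pairs(2) \<open>e \<in> pair_edges core_pairs\<close>] by simp
next
  case (Suc k)
  then consider f where "f \<in> ladder k" "e = (+) 9 ` f"
    | f where "f \<in> pair_edges layer_pairs" "e = layer_pos k ` f" by auto
  then show ?case
  proof cases
    case 1
    then show ?thesis using Suc.IH[of f] by (auto simp: card_image)
  next
    case 2
    have "\<forall>(a, b)\<in>set layer_pairs. a \<le> 19 \<and> b \<le> 19" by code_simp
    then have "f \<subseteq> {0..19}" using 2(1) by (force simp: pair_edges_def)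
    then have "e \<subseteq> {0..18 * Suc k + 17}"
      unfolding 2(2) by (force simp: layer_pos_def)
    moreover have "card e = 2"
      using 2 card_in_pair_edges[OF ordered_pairs(1)] strict_mono_imp_inj_on[OF strict_mono_pos(1), of k f]
      by (simp add: card_image)
    ultimately show ?thesis by blast
  qed
qed

lemma finite_ladder [simp]: "finite (ladder k)"
  by (induction k) simp_all

lemma shifted_ladder_edge: "e \<in> (`) ((+) 9) ` ladder k \<Longrightarrow> e \<subseteq> {9..18 * k + 26}"
proof -
  assume "e \<in> (`) ((+) 9) ` ladder k"
  then obtain f where f: "f \<in> ladder k" "e = (+) 9 ` f" by blast
  have "f \<subseteq> {0..18 * k + 17}" using ladder_edge[OF f(1)] by blast
  then show "e \<subseteq> {9..18 * k + 26}" unfolding f(2) by auto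
qed

text \<open>The second claim holds because (9, 10) is not listed: every layer edge has an end off
  the enclosed ladder. This gives the disjointness needed to add cardinalities and degrees.\<close>

lemma layer_edge:
  assumes "e \<in> (`) (layer_pos k) ` pair_edges layer_pairs"
  shows "e \<subseteq> {..9} \<union> {18 * k + 26..}" "\<not> e \<subseteq> {9..18 * k + 26}"
proof -
  obtain f where f: "f \<in> pair_edges layer_pairs" "e = layer_pos k ` f" using assms by blast
  show "e \<subseteq> {..9} \<union> {18 * k + 26..}" unfolding f by (auto simp: layer_pos_def)
  have "\<forall>(a, b)\<in>set layer_pairs. a < 9 \<or> 10 < b" by code_simp
  then obtain x where x: "x \<in> f" "x < 9 \<or> 10 < x" using f(1) by (force simp: pair_edges_def)
  then have "layer_pos k x \<in> e" "layer_pos k x \<notin> {9..18 * k + 26}"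
    unfolding f by (auto simp: layer_pos_def)
  then show "\<not> e \<subseteq> {9..18 * k + 26}" by blast
qed

lemma ladder_disjoint: "(`) ((+) 9) ` ladder k \<inter> (`) (layer_pos k) ` pair_edges layer_pairs = {}"
  unfolding disjoint_iff using shifted_ladder_edge layer_edge(2) by iprover

lemma noncrossing_ladder: "noncrossing (ladder k)"
proof (induction k)
  case (Suc k)
  have inner: "noncrossing ((`) ((+) 9) ` ladder k)"
    using Suc by (intro noncrossing_image) (auto simp: strict_mono_def)
  have outer: "noncrossing ((`) (layer_pos k) ` pair_edges layer_pairs)"
    by (intro noncrossing_image strict_mono_pos noncrossing_pairs)
  show ?case
    unfolding ladder.simps by (rule noncrossing_glue[OF inner shifted_ladder_edge outer layer_edge(1)])
qed (simp add: noncrossing_pairs)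

lemma card_image_edges: "inj f \<Longrightarrow> card ((`) f ` E) = card E"
  by (simp add: card_image inj_on_def inj_image_eq_iff)

text \<open>The value is 2N-3 for the N = 18k+18 vertices of the ladder, the count of a triangulated
  polygon.\<close>

lemma card_ladder: "card (ladder k) = 36 * k + 33"
proof (induction k)
  case 0
  show ?case by (simp add: card_pair_edges[OF ordered_pairs(2) distinct_pairs(2)]) (simp add: core_pairs_def)
next
  case (Suc k)
  have "card (ladder (Suc k)) = card (ladder k) + card (pair_edges layer_pairs)"
    using ladder_disjoint strict_mono_imp_inj_on[OF strict_mono_pos(1)]
    by (simp add: card_Un_disjoint card_image_edges)
  also have "card (pair_edges layer_pairs) = 36"
    by (simp add: card_pair_edges[OF ordered_pairs(1) distinct_pairs(1)]) (simp add: layer_pairs_def)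
  finally show ?case using Suc by simp
qed

section \<open>The degrees and the spread of the graph\<close>

definition cap :: "nat \<Rightarrow> nat set set" where
  "cap k = (`) (cap_pos k) ` pair_edges cap_pairs"

lemma cap_eq:
  "cap k = {{18 * k + 17, 18 * k + 18}, {18 * k + 18, 18 * k + 19}, {0, 18 * k + 19}, {18 * k + 17, 18 * k + 19}}"
  by (simp add: cap_def pair_edges_def cap_pairs_def cap_pos_def insert_commute add.commute)

text \<open>With the ends of the innermost path counted as if the cap were attached to them, the degrees of
  the inner vertices do not change when a layer is added.\<close>

definition capped_degree :: "nat \<Rightarrow> nat \<Rightarrow> nat" where
  "capped_degree k v = degree (ladder k) v + (if v = 0 then 1 else 0) + (if v = 18 * k + 17 then 2 else 0)"

lemma degree_ladder_Suc:
  "degree (ladder (Suc k)) v =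
     degree ((`) ((+) 9) ` ladder k) v + degree ((`) (layer_pos k) ` pair_edges layer_pairs) v"
  unfolding ladder.simps using ladder_disjoint by (intro degree_Un) auto

lemma degree_layer_pos:
  "degree ((`) (layer_pos k) ` pair_edges layer_pairs) (layer_pos k l) = degree (pair_edges layer_pairs) l"
  by (rule degree_image[OF strict_mono_imp_inj_on[OF strict_mono_pos(1)]])

lemma degree_layer_pairs:
  "l < 20 \<Longrightarrow> degree (pair_edges layer_pairs) l = [7, 2, 5, 2, 5, 2, 5, 2, 5, 1, 2, 8, 2, 5, 2, 5, 2, 5, 2, 3] ! l"
  using arg_cong[OF degrees_pairs(1), of "\<lambda>xs. xs ! l"] by simp

text \<open>The layer touches the enclosed ladder only at its labels 9 and 10, with degrees 1 and 2.
  These replace the two corrections that \<open>capped_degree\<close> makes at the old ends.\<close>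

lemma capped_degree_shift:
  assumes "v < 18 * k + 18"
  shows "capped_degree (Suc k) (9 + v) = capped_degree k v"
proof -
  let ?L = "(`) (layer_pos k) ` pair_edges layer_pairs"
  have "degree ?L (9 + v) = (if v = 0 then 1 else 0) + (if v = 18 * k + 17 then 2 else 0)"
  proof -
    consider "v = 0" | "v = 18 * k + 17" | "0 < v" "v < 18 * k + 17"
      using assms by linarith
    then show ?thesis
    proof cases
      case 1
      then show ?thesis
        using degree_layer_pos[of k 9] degree_layer_pairs[of 9] by (simp add: layer_pos_def)
    next
      case 2
      then show ?thesis
        using degree_layer_pos[of k 10] degree_layer_pairs[of 10] by (simp add: layer_pos_def)
    next
      case 3
      have "9 + v \<notin> e" if "e \<in> ?L" for e
        using subsetD[OF layer_edge(1)[OF that], of "9 + v"] 3 by auto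
      then show ?thesis using degree_outside[of ?L "9 + v"] 3 by simp
    qed
  qed
  moreover have "degree ((`) ((+) 9) ` ladder k) (9 + v) = degree (ladder k) v"
    by (rule degree_image) simp
  ultimately show ?thesis
    using assms unfolding capped_degree_def degree_ladder_Suc by simp
qed

lemma capped_degree_layer:
  assumes "l < 20" "l \<noteq> 9" "l \<noteq> 10"
  shows "capped_degree (Suc k) (layer_pos k l) = [8, 2, 5, 2, 5, 2, 5, 2, 5, 1, 2, 8, 2, 5, 2, 5, 2, 5, 2, 5] ! l"
proof -
  have "layer_pos k l \<notin> e" if "e \<in> (`) ((+) 9) ` ladder k" for e
    using subsetD[OF shifted_ladder_edge[OF that], of "layer_pos k l"] assms
    by (auto simp: layer_pos_def split: if_splits)
  then have 1: "degree (ladder (Suc k)) (layer_pos k l) = degree (pair_edges layer_pairs) l"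
    unfolding degree_ladder_Suc degree_layer_pos by (simp add: degree_outside)
  have 2: "layer_pos k l = 0 \<longleftrightarrow> l = 0" "layer_pos k l = 18 * Suc k + 17 \<longleftrightarrow> l = 19"
    using assms by (auto simp: layer_pos_def)
  \<comment> \<open>The two lists differ only at the ends of the new outer rung, where the cap
    corrections apply: 7+1 = 8 and 3+2 = 5.\<close>
  have "\<forall>l\<in>set [0..<20]. l \<noteq> 9 \<longrightarrow> l \<noteq> 10 \<longrightarrow>
      [7, 2, 5, 2, 5, 2, 5, 2, 5, 1, 2, 8, 2, 5, 2, 5, 2, 5, 2, 3] ! l + (if l = 0 then 1 else 0) + (if l = 19 then 2 else 0)
      = ([8, 2, 5, 2, 5, 2, 5, 2, 5, 1, 2, 8, 2, 5, 2, 5, 2, 5, 2, 5] ! l :: nat)"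
    by code_simp
  then show ?thesis
    unfolding capped_degree_def 1 2 degree_layer_pairs[OF assms(1)] using assms by simp
qed

text \<open>The core contributes seven 2s, one 3, eight 5s and two 6s. The 18 new vertices of each
  layer contribute eight 2s, eight 5s and two 8s.\<close>

lemma capped_degrees:
  "image_mset (capped_degree k) (mset_set {..<18 * k + 18}) =
     replicate_mset (8 * k + 7) 2 + {#3#} + replicate_mset (8 * k + 8) 5 + replicate_mset 2 6 + replicate_mset (2 * k) 8"
proof (induction k)
  case 0
  have "map (capped_degree 0) [0..<18] =
      map (\<lambda>v. [4, 5, 2, 6, 2, 5, 2, 5, 2, 3, 6, 2, 5, 5, 2, 5, 2, 3] ! v
        + (if v = 0 then 1 else 0) + (if v = 17 then 2 else 0)) [0..<18]"
  proof (rule map_cong[OF refl])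
    fix v assume "v \<in> set [0..<18::nat]"
    then have "degree (pair_edges core_pairs) v = [4, 5, 2, 6, 2, 5, 2, 5, 2, 3, 6, 2, 5, 5, 2, 5, 2, 3] ! v"
      using arg_cong[OF degrees_pairs(2), of "\<lambda>xs. xs ! v"] by simp
    then show "capped_degree 0 v = [4, 5, 2, 6, 2, 5, 2, 5, 2, 3, 6, 2, 5, 5, 2, 5, 2, 3] ! v
        + (if v = 0 then 1 else 0) + (if v = 17 then 2 else 0)"
      by (simp add: capped_degree_def)
  qed
  also have "\<dots> = [5, 5, 2, 6, 2, 5, 2, 5, 2, 3, 6, 2, 5, 5, 2, 5, 2, 5]"
    by code_simp
  finally have "mset (map (capped_degree 0) [0..<18]) = mset [5, 5, 2, 6, 2, 5, 2, 5, 2, 3, 6, 2, 5, 5, 2, 5, 2, 5]"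
    by simp
  moreover have "mset_set {..<18 * 0 + 18} = mset [0..<18::nat]"
    by (simp add: mset_upt lessThan_atLeast0)
  ultimately have "image_mset (capped_degree 0) (mset_set {..<18 * 0 + 18}) =
      mset [5, 5, 2, 6, 2, 5, 2, 5, 2, 3, 6, 2, 5, 5, 2, 5, 2, 5]"
    by (simp only: mset_map)
  also have "\<dots> = replicate_mset (8 * 0 + 7) 2 + {#3#} + replicate_mset (8 * 0 + 8) 5 + replicate_mset 2 6 + replicate_mset (2 * 0) 8"
    by (simp add: numeral_eq_Suc)
  finally show ?case .
next
  case (Suc k)
  \<comment> \<open>Labels 9 and 10 are skipped: their positions are the ends of the shifted ladder
    and are counted there.\<close>
  let ?I = "[0..<9] @ [11..<20]" and ?V = "{..<18 * k + 18}"
  have split: "{..<18 * Suc k + 18} = (+) 9 ` ?V \<union> layer_pos k ` set ?I"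
  proof (intro equalityI subsetI)
    fix v assume v: "v \<in> {..<18 * Suc k + 18}"
    consider "v < 9" | "9 \<le> v" "v < 18 * k + 27" | "18 * k + 27 \<le> v" by linarith
    then show "v \<in> (+) 9 ` ?V \<union> layer_pos k ` set ?I"
    proof cases
      case 1
      then have "v = layer_pos k v" "v \<in> set ?I" by (simp_all add: layer_pos_def)
      then show ?thesis by blast
    next
      case 2
      then have "v = 9 + (v - 9)" "v - 9 \<in> ?V" by auto
      then show ?thesis by blast
    next
      case 3
      then have "v = layer_pos k (v - (18 * k + 16))"
        by (simp add: layer_pos_def)
      moreover have "v - (18 * k + 16) \<in> set ?I"
        using 3 v by simp linarith
      ultimately show ?thesis by blast
    qed
  qed (auto simp: layer_pos_def split: if_splits)
  have disj: "(+) 9 ` ?V \<inter> layer_pos k ` set ?I = {}"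
    by (auto simp: layer_pos_def)
  have inj: "inj_on (layer_pos k) (set ?I)"
    by (rule inj_on_subset[OF strict_mono_imp_inj_on[OF strict_mono_pos(1)] subset_UNIV])
  have "image_mset (capped_degree (Suc k)) (mset_set ((+) 9 ` ?V))
      = image_mset (\<lambda>v. capped_degree (Suc k) (9 + v)) (mset_set ?V)"
    by (simp add: image_mset_mset_set[symmetric] multiset.map_comp comp_def)
  also have "\<dots> = image_mset (capped_degree k) (mset_set ?V)"
    by (intro image_mset_cong) (simp add: capped_degree_shift)
  finally have inner: "image_mset (capped_degree (Suc k)) (mset_set ((+) 9 ` ?V)) = image_mset (capped_degree k) (mset_set ?V)" .
  have "image_mset (capped_degree (Suc k)) (mset_set (layer_pos k ` set ?I))
      = image_mset (\<lambda>l. capped_degree (Suc k) (layer_pos k l)) (mset_set (set ?I))"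
    using inj by (simp add: image_mset_mset_set[symmetric] multiset.map_comp comp_def)
  also have "mset_set (set ?I) = mset ?I"
    by (rule mset_set_set) auto
  also have "image_mset (\<lambda>l. capped_degree (Suc k) (layer_pos k l)) (mset ?I)
      = image_mset ((!) [8, 2, 5, 2, 5, 2, 5, 2, 5, 1, 2, 8, 2, 5, 2, 5, 2, 5, 2, 5]) (mset ?I)"
    by (intro image_mset_cong capped_degree_layer) auto
  also have "\<dots> = mset (map ((!) [8, 2, 5, 2, 5, 2, 5, 2, 5, 1, 2, 8, 2, 5, 2, 5, 2, 5, 2, 5]) ?I)"
    by (simp only: mset_map)
  also have "map ((!) [8, 2, 5, 2, 5, 2, 5, 2, 5, 1, 2, 8, 2, 5, 2, 5, 2, 5, 2, 5]) ?I
      = [8, 2, 5, 2, 5, 2, 5, 2, 5, 8, 2, 5, 2, 5, 2, 5, 2, 5::nat]"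
    by code_simp
  also have "mset \<dots> = replicate_mset 8 2 + replicate_mset 8 5 + replicate_mset 2 8"
    by (simp add: numeral_eq_Suc)
  finally have outer: "image_mset (capped_degree (Suc k)) (mset_set (layer_pos k ` set ?I))
      = replicate_mset 8 2 + replicate_mset 8 5 + replicate_mset 2 8" .
  have exps: "8 * Suc k + 7 = (8 * k + 7) + 8" "8 * Suc k + 8 = (8 * k + 8) + 8" "2 * Suc k = 2 * k + 2" by simp_all
  have "image_mset (capped_degree (Suc k)) (mset_set {..<18 * Suc k + 18})
      = image_mset (capped_degree k) (mset_set ?V) + (replicate_mset 8 2 + replicate_mset 8 5 + replicate_mset 2 8)"
    unfolding split using disj inner outer by (subst mset_set_Union) simp_all
  then show ?case
    unfolding Suc exps by (intro multiset_eqI) simp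
qed

lemma cap_edge: "e \<in> cap k \<Longrightarrow> e \<subseteq> {..0} \<union> {18 * k + 17..} \<and> \<not> e \<subseteq> {0..18 * k + 17} \<and> e \<subseteq> {..18 * k + 19} \<and> card e = 2"
  unfolding cap_eq by auto

lemma ladder_cap_disjoint: "ladder k \<inter> cap k = {}"
  unfolding disjoint_iff using ladder_edge cap_edge by iprover

lemma finite_cap [simp]: "finite (cap k)"
  by (simp add: cap_def)

lemma degree_sequence_capped:
  "degree_sequence {..<18 * k + 20} (ladder k \<union> cap k) =
     replicate_mset (8 * k + 8) 2 + replicate_mset 2 3 + replicate_mset (8 * k + 8) 5 +
     replicate_mset 2 6 + replicate_mset (2 * k) 8"
proof -
  let ?d = "degree (ladder k \<union> cap k)" and ?N = "18 * k + 17"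
  have d: "?d v = degree (ladder k) v + degree (cap k) v" for v
    using ladder_cap_disjoint by (intro degree_Un) auto
  have c: "degree (cap k) (cap_pos k l) = [1, 2, 2, 3] ! l" if "l < 4" for l
    unfolding cap_def degree_image[OF strict_mono_imp_inj_on[OF strict_mono_pos(2)]]
    using arg_cong[OF degrees_pairs(3), of "\<lambda>xs. xs ! l"] that by simp
  have "?d v = capped_degree k v" if "v \<in># mset_set {..<18 * k + 18}" for v
  proof -
    have "v < 18 * k + 18" using that by simp
    then consider "v = 0" | "v = ?N" | "0 < v" "v < ?N" by linarith
    then have "degree (cap k) v = (if v = 0 then 1 else 0) + (if v = ?N then 2 else 0)"
    proof cases
      case 1
      then show ?thesis using c[of 0] by (simp add: cap_pos_def)
    next
      case 2
      then show ?thesis using c[of 1] by (simp add: cap_pos_def add.commute)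
    next
      case 3
      have "v \<notin> e" if "e \<in> cap k" for e
        using cap_edge[OF that] 3 by auto
      then show ?thesis using 3 by (simp add: degree_outside)
    qed
    then show ?thesis unfolding d capped_degree_def by simp
  qed
  then have inner: "image_mset ?d (mset_set {..<18 * k + 18}) = image_mset (capped_degree k) (mset_set {..<18 * k + 18})"
    by (rule image_mset_cong)
  have out: "degree (ladder k) v = 0" if "v > ?N" for v
    using degree_outside[of "ladder k" v] ladder_edge[of _ k] that by fastforce
  \<comment> \<open>The two vertices outside the ladder supply the eighth 2 of the base case and the
    second 3.\<close>
  have tips: "?d (?N + 1) = 2" "?d (?N + 2) = 3"
    unfolding d using out[of "?N + 1"] out[of "?N + 2"] c[of 2] c[of 3] by (simp_all add: cap_pos_def add.commute)
  have "{..<18 * k + 20} = insert (?N + 2) (insert (?N + 1) {..<18 * k + 18})"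
    by auto
  then have "degree_sequence {..<18 * k + 20} (ladder k \<union> cap k)
      = {#2, 3#} + image_mset (capped_degree k) (mset_set {..<18 * k + 18})"
    unfolding degree_sequence_def using tips inner by (simp add: numeral_eq_Suc)
  also have "\<dots> = {#2, 3#} + (replicate_mset (8 * k + 7) 2 + {#3#} + replicate_mset (8 * k + 8) 5 + replicate_mset 2 6 + replicate_mset (2 * k) 8)"
    unfolding capped_degrees ..
  also have "\<dots> = replicate_mset (8 * k + 8) 2 + replicate_mset 2 3 + replicate_mset (8 * k + 8) 5 +
     replicate_mset 2 6 + replicate_mset (2 * k) 8"
    by (rule multiset_eqI) simp
  finally show ?thesis .
qed

lemma noncrossing_capped: "noncrossing (ladder k \<union> cap k)"
proof (rule noncrossing_glue[OF noncrossing_ladder])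
  show "noncrossing (cap k)"
    unfolding cap_def by (intro noncrossing_image strict_mono_pos noncrossing_pairs)
  show "e \<in> ladder k \<Longrightarrow> e \<subseteq> {0..18 * k + 17}" for e using ladder_edge by iprover
  show "e \<in> cap k \<Longrightarrow> e \<subseteq> {..0} \<union> {18 * k + 17..}" for e using cap_edge by iprover
qed

lemma card_capped: "card (ladder k \<union> cap k) = 36 * k + 37"
proof -
  have "card (cap k) = card (pair_edges cap_pairs)"
    unfolding cap_def by (rule card_image_edges[OF strict_mono_imp_inj_on[OF strict_mono_pos(2)]])
  also have "\<dots> = 4"
    by (simp add: card_pair_edges[OF ordered_pairs(3) distinct_pairs(3)]) (simp add: cap_pairs_def)
  finally show ?thesis
    using ladder_cap_disjoint by (simp add: card_Un_disjoint card_ladder)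
qed


section \<open>Identification with the given graph\<close>

lemma H_phi_Suc: "i < k \<Longrightarrow> H_phi (Suc (Suc k)) (Suc i) l = 9 + H_phi (Suc k) i l"
  by (simp add: H_phi_def H_a_def H_b_def)

text \<open>When the parameter and the index both grow by one, \<open>H_b\<close> gains 18 and loses
  9, so both sides of the block move by 9.\<close>

lemma H_block_Suc: "i < k \<Longrightarrow> H_block (Suc (Suc k)) (Suc i) = (`) ((+) 9) ` H_block (Suc k) i"
  unfolding H_block_def image_image by (intro image_cong) (auto simp: H_phi_Suc)

lemma H_Gamma_Suc: "H_Gamma (Suc (Suc k)) = (`) ((+) 9) ` H_Gamma (Suc k)"
  unfolding H_Gamma_def image_image by (intro image_cong) (auto simp: H_c_def)

lemma H_rung_Suc: "i < Suc k \<Longrightarrow> H_rung (Suc (Suc k)) (Suc i) = (+) 9 ` H_rung (Suc k) i"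
  by (auto simp: H_rung_def H_c_def H_a_def H_b_def)

lemma H_phi_0: "H_phi (Suc (Suc k)) 0 l = layer_pos k l" if "l < 20" for l
  using that by (simp add: H_phi_def H_a_def H_b_def layer_pos_def)

text \<open>Only a path of sides appears, not a cycle: the edge closing the ladder polygon is the
  outermost rung.\<close>

lemma ladder_eq:
  "ladder k = (\<lambda>i. {i, Suc i}) ` {0..<18 * k + 17} \<union> H_rung (Suc k) ` {..<Suc k} \<union>
     (\<Union>i<k. H_block (Suc k) i) \<union> H_Gamma (Suc k)"
proof (induction k)
  case 0
  let ?G = "[(0, 13), (0, 15), (1, 3), (1, 12), (1, 13), (3, 5), (3, 10), (3, 12), (5, 7), (5, 10), (7, 9), (7, 10),
      (10, 12), (13, 15), (15, 17), (0, 17)] :: (nat \<times> nat) list"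
  \<comment> \<open>\<open>?G\<close> collects the chords of \<open>H_Gamma\<close> and the only
    rung; the rest is the path of sides.\<close>
  have core: "core_pairs = ?G @ map (\<lambda>i. (i, Suc i)) [0..<17]" by code_simp
  have edges: "pair_edges core_pairs = (\<lambda>(a, b). {a, b}) ` set ?G \<union> (\<lambda>i. {i, Suc i}) ` {0..<17}"
    unfolding pair_edges_def core by (simp only: set_append image_Un set_map set_upt image_image split_conv)
  have rungs: "H_rung (Suc 0) ` {..<Suc 0} \<union> H_Gamma (Suc 0) = (\<lambda>(a, b). {a, b}) ` set ?G"
    by (simp add: H_rung_def H_c_def H_Gamma_def insert_commute lessThan_Suc)
  have "P \<union> R \<union> (\<Union>i<0. B i) \<union> G = (R \<union> G) \<union> P" for P R G :: "nat set set" and B :: "nat \<Rightarrow> nat set set"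
    by auto
  then show ?case unfolding ladder.simps edges rungs[symmetric] by simp
next
  case (Suc k)
  let ?sh = "(`) ((+) 9)" and ?path = "\<lambda>i::nat. {i, Suc i}"
  \<comment> \<open>The path consists of nine new edges below, the shifted old path and nine new
    edges above.\<close>
  have path: "?path ` {0..<18 * Suc k + 17} =
      ?path ` {0..<9} \<union> ?sh ` ?path ` {0..<18 * k + 17} \<union> ?path ` (\<lambda>i. i + 18 * k + 16) ` {10..<19}"
  proof -
    have range: "{0..<18 * Suc k + 17} = {0..<9} \<union> (+) 9 ` {0..<18 * k + 17} \<union> (\<lambda>i. i + 18 * k + 16) ` {10..<19}"
    proof -
      have "(\<lambda>i. i + 18 * k + 16) ` {10..<19} = (\<lambda>i. i + (18 * k + 16)) ` {10..<19}" by (simp add: add.assoc)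
      also have "\<dots> = {18 * k + 26..<18 * k + 35}" by (simp only: image_add_atLeastLessThan') (simp add: add.commute)
      finally have "(\<lambda>i. i + 18 * k + 16) ` {10..<19} = {18 * k + 26..<18 * k + 35}" .
      moreover have "(+) 9 ` {0..<18 * k + 17} = {9..<18 * k + 26}" by (simp add: image_add_atLeastLessThan add.commute)
      ultimately show ?thesis by auto
    qed
    have "?sh ` ?path ` I = ?path ` (+) 9 ` I" for I
      by (simp add: image_image)
    then show ?thesis unfolding range image_Un by simp
  qed
  have "{..<Suc (Suc k)} = insert 0 (Suc ` {..<Suc k})"
    by (rule lessThan_Suc_eq_insert_0)
  then have "H_rung (Suc (Suc k)) ` {..<Suc (Suc k)} =
      insert (H_rung (Suc (Suc k)) 0) ((\<lambda>i. H_rung (Suc (Suc k)) (Suc i)) ` {..<Suc k})"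
    by (simp add: image_image)
  also have "(\<lambda>i. H_rung (Suc (Suc k)) (Suc i)) ` {..<Suc k} = ?sh ` H_rung (Suc k) ` {..<Suc k}"
    unfolding image_image by (intro image_cong refl H_rung_Suc) simp
  finally have rungs: "H_rung (Suc (Suc k)) ` {..<Suc (Suc k)} =
      insert (H_rung (Suc (Suc k)) 0) (?sh ` H_rung (Suc k) ` {..<Suc k})" .
  have "(\<Union>i<Suc k. H_block (Suc (Suc k)) i) =
      H_block (Suc (Suc k)) 0 \<union> (\<Union>i<k. H_block (Suc (Suc k)) (Suc i))"
    unfolding lessThan_Suc_eq_insert_0 by simp
  also have "(\<Union>i<k. H_block (Suc (Suc k)) (Suc i)) = ?sh ` (\<Union>i<k. H_block (Suc k) i)"
    unfolding image_UN by (intro SUP_cong refl H_block_Suc) simp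
  finally have blocks: "(\<Union>i<Suc k. H_block (Suc (Suc k)) i) =
      H_block (Suc (Suc k)) 0 \<union> ?sh ` (\<Union>i<k. H_block (Suc k) i)" .
  have layer: "(`) (layer_pos k) ` pair_edges layer_pairs =
      insert (H_rung (Suc (Suc k)) 0) (H_block (Suc (Suc k)) 0) \<union>
      (?path ` {0..<9} \<union> ?path ` (\<lambda>i. i + 18 * k + 16) ` {10..<19})"
  proof -
    let ?f = "\<lambda>(a, b). {layer_pos k a, layer_pos k b}"
    have img: "(`) (layer_pos k) ` pair_edges ps = ?f ` set ps" for ps
      unfolding pair_edges_def image_image by (intro image_cong) auto
    let ?B = "[(0, 2), (2, 4), (4, 6), (6, 8), (0, 11), (0, 13), (0, 15), (0, 17), (2, 11), (4, 11), (6, 11), (8, 11),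
      (11, 13), (13, 15), (15, 17), (17, 19), (8, 10::nat)] :: (nat \<times> nat) list"
    have pairs: "layer_pairs = ?B @ [(0, 19)] @ map (\<lambda>i. (i, Suc i)) [0..<9] @ map (\<lambda>i. (i, Suc i)) [10..<19]"
      by code_simp
    have "?f ` set layer_pairs = ?f ` set ?B \<union> (?f ` set [(0, 19)] \<union>
        ((\<lambda>i. {layer_pos k i, layer_pos k (Suc i)}) ` {0..<9} \<union>
        (\<lambda>i. {layer_pos k i, layer_pos k (Suc i)}) ` {10..<19}))"
      unfolding pairs by (simp only: set_append image_Un set_map set_upt image_image split_conv)
    also have "(\<lambda>i. {layer_pos k i, layer_pos k (Suc i)}) ` {0..<9} = ?path ` {0..<9}"
      by (intro image_cong) (auto simp: layer_pos_def)
    also have "(\<lambda>i. {layer_pos k i, layer_pos k (Suc i)}) ` {10..<19} = ?path ` (\<lambda>i. i + 18 * k + 16) ` {10..<19}"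
      unfolding image_image by (intro image_cong) (auto simp: layer_pos_def)
    also have "?f ` set ?B = H_block (Suc (Suc k)) 0"
      unfolding H_block_def by (simp add: H_phi_0)
    also have "?f ` set [(0, 19)] = {H_rung (Suc (Suc k)) 0}"
      by (simp add: layer_pos_def H_rung_def H_a_def H_b_def add.commute)
    finally show ?thesis unfolding img by simp
  qed
  have "(P \<union> R \<union> B \<union> G) \<union> (insert r B' \<union> (P1 \<union> P2)) = (P1 \<union> P \<union> P2) \<union> insert r R \<union> (B' \<union> B) \<union> G"
    for P R B G B' P1 P2 :: "nat set set" and r
    by blast
  then show ?case
    unfolding ladder.simps path rungs blocks H_Gamma_Suc layer Suc image_Un .
qed

text \<open>The cap consists of the three sides missing from the path of the ladder, together with
  the chord cutting off the vertex n-2.\<close>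

lemma H_edges_eq: "H_edges (Suc k) = ladder k \<union> cap k"
proof -
  have "{0..<18 * k + 19} = insert (18 * k + 18) (insert (18 * k + 17) {0..<18 * k + 17})" by auto
  then have boundary: "boundary_edges (H_order (Suc k)) = insert {0, 18 * k + 19} (insert {18 * k + 18, 18 * k + 19}
      (insert {18 * k + 17, 18 * k + 18} ((\<lambda>i. {i, Suc i}) ` {0..<18 * k + 17})))"
    by (simp add: boundary_edges_image H_order_def add.commute)
  have tip: "{H_order (Suc k) - 3, H_order (Suc k) - 1} = {18 * k + 17, 18 * k + 19}"
    by (simp add: H_order_def add.commute)
  have "insert z (insert y (insert x P)) \<union> ({w} \<union> R \<union> B \<union> G) = (P \<union> R \<union> B \<union> G) \<union> {x, y, z, w}"
    for P R B G :: "nat set set" and x y z w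
    by blast
  then show ?thesis
    unfolding H_edges_def H_chords_def ladder_eq cap_eq boundary tip diff_Suc_1 .
qed

text \<open>Two crude bounds meet, so coincidences among the listed chords need no inspection. The
  union bound gives at most 1 + (k+1) + 17k + 15; conversely, the 36k+37 edges include at most
  18k+20 sides.\<close>

lemma card_H_chords:
  shows "card (H_chords (Suc k)) = 18 * k + 17"
proof (rule antisym)
  have fin: "finite (H_block l i)" "card (H_block l i) \<le> 17" for l i
    unfolding H_block_def by (simp, rule order_trans[OF card_image_le]) simp_all
  have fin\<Gamma>: "finite (H_Gamma l)" "card (H_Gamma l) \<le> 15" for l
    unfolding H_Gamma_def by (simp, rule order_trans[OF card_image_le]) simp_all
  have "card (\<Union>i<k. H_block (Suc k) i) \<le> (\<Sum>i<k. card (H_block (Suc k) i))"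
    by (rule card_UN_le) simp
  also have "\<dots> \<le> (\<Sum>i<k. 17)" by (intro sum_mono fin)
  finally have "card (\<Union>i<k. H_block (Suc k) i) \<le> 17 * k" by simp
  moreover have "card (H_rung (Suc k) ` {..<Suc k}) \<le> Suc k"
    using card_image_le[of "{..<Suc k}" "H_rung (Suc k)"] by simp
  moreover have "card (H_chords (Suc k)) \<le> 1 + card (H_rung (Suc k) ` {..<Suc k}) +
      card (\<Union>i<k. H_block (Suc k) i) + card (H_Gamma (Suc k))"
  proof -
    have Un4: "card (A \<union> B \<union> C \<union> D) \<le> card A + card B + card C + card D" for A B C D :: "nat set set"
      by (meson add_le_mono1 card_Un_le order_trans)
    show ?thesis
      unfolding H_chords_def by (rule order_trans[OF Un4]) simp
  qed
  ultimately show "card (H_chords (Suc k)) \<le> 18 * k + 17"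
    using fin\<Gamma>(2)[of "Suc k"] by linarith
  have "card (boundary_edges (18 * k + 20)) \<le> Suc (card ((\<lambda>i. {i, Suc i}) ` {0..<18 * k + 19}))"
  proof -
    have "boundary_edges (18 * k + 20) = insert {0, 18 * k + 19} ((\<lambda>i. {i, Suc i}) ` {0..<18 * k + 19})"
      by (simp add: boundary_edges_image add.commute)
    then show ?thesis by (simp add: card_insert_if)
  qed
  also have "\<dots> \<le> 18 * k + 20"
    using card_image_le[of "{0..<18 * k + 19}" "\<lambda>i. {i, Suc i}"] by simp
  finally have "card (boundary_edges (18 * k + 20)) \<le> 18 * k + 20" .
  moreover have "36 * k + 37 \<le> card (boundary_edges (18 * k + 20)) + card (H_chords (Suc k))"
    using card_Un_le[of "boundary_edges (H_order (Suc k))" "H_chords (Suc k)"] card_capped[of k]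
    by (simp add: H_edges_eq[symmetric] H_edges_def H_order_def add.commute)
  ultimately show "18 * k + 17 \<le> card (H_chords (Suc k))" by linarith
qed

text \<open>A set of spread at most \<open>r\<close> lies in the degree window starting at its
  minimum degree, and a full window has spread at most \<open>r\<close>. Positivity of
  \<open>s\<close> makes the extremal window nonempty, as required of the sets in
  \<open>sp\<close>.\<close>

lemma sp_eqI:
  assumes fin: "finite V"
    and upper: "\<And>m. card {v \<in> V. m \<le> degree E v \<and> degree E v \<le> m + r} \<le> s"
    and lower: "card {v \<in> V. l \<le> degree E v \<and> degree E v \<le> l + r} = s" "s > 0"
  shows "sp V E (int r) = s"
proof -
  let ?S = "{B. B \<subseteq> V \<and> B \<noteq> {} \<and> spread E B \<le> int r}"
  let ?B = "{v \<in> V. l \<le> degree E v \<and> degree E v \<le> l + r}"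
  have "finite ?S" using fin by (intro finite_subset[of ?S "Pow V"]) auto
  have le: "card B \<le> s" if B: "B \<in> ?S" for B
  proof -
    have finB: "finite B" using B fin finite_subset by blast
    let ?m = "Min (degree E ` B)"
    have "?m \<le> degree E v \<and> degree E v \<le> ?m + r" if "v \<in> B" for v
    proof -
      have "degree E v \<le> Max (degree E ` B)" "?m \<le> degree E v" using that finB by simp_all
      then show ?thesis using B unfolding spread_def by auto
    qed
    then have "B \<subseteq> {v \<in> V. ?m \<le> degree E v \<and> degree E v \<le> ?m + r}" using B by blast
    then have "card B \<le> card {v \<in> V. ?m \<le> degree E v \<and> degree E v \<le> ?m + r}"
      using fin by (intro card_mono) auto
    then show ?thesis using upper[of ?m] by linarith
  qed
  have ne: "?B \<noteq> {}" using lower card.empty by (metis less_irrefl)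
  have finB: "finite ?B" using fin by simp
  have "Max (degree E ` ?B) \<le> l + r" "l \<le> Min (degree E ` ?B)"
    using ne finB by auto
  then have "?B \<in> ?S" using ne unfolding spread_def by auto
  then show ?thesis
    unfolding sp_def using \<open>finite ?S\<close> le lower(1)
    by (intro Max_eqI) auto
qed

lemma card_degree_window:
  assumes "finite V"
  shows "card {v \<in> V. P (degree E v)} = size (filter_mset P (degree_sequence V E))"
  unfolding degree_sequence_def filter_mset_image_mset by (simp add: assms)

theorem theorem20:
  fixes k n :: nat
  assumes "k \<ge> 1" and "n = 18 * k + 2"
  shows "card (H_chords k) = 18 * k - 1 \<and>
    maximal_outerplanar (H_verts k) (H_edges k) \<and>
    degree_sequence (H_verts k) (H_edges k) =
      replicate_mset (8 * k) 2 + replicate_mset 2 3 + replicate_mset (8 * k) 5 +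
      replicate_mset 2 6 + replicate_mset (2 * k - 2) 8 \<and>
    sp (H_verts k) (H_edges k) 2 = 8 * k + 2 \<and>
    real (sp (H_verts k) (H_edges k) 2) = (4 * real n + 10) / 9"
proof -
  obtain j where k: "k = Suc j" using assms(1) by (cases k) auto
  have V: "H_verts k = {..<18 * j + 20}" by (simp add: H_verts_def H_order_def k)
  have E: "H_edges k = ladder j \<union> cap j" by (simp add: k H_edges_eq)
  have chords: "card (H_chords k) = 18 * k - 1"
    by (simp add: k card_H_chords)
  have maximal: "maximal_outerplanar (H_verts k) (H_edges k)"
    unfolding V
  proof (rule triangulation_maximal_outerplanar)
    show "simple_graph {..<18 * j + 20} (H_edges k)"
      unfolding simple_graph_def E using ladder_edge[of _ j] cap_edge[of _ j] by fastforce
    show "noncrossing (H_edges k)" unfolding E by (rule noncrossing_capped)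
    show "boundary_edges (18 * j + 20) \<subseteq> H_edges k"
      by (simp add: H_edges_def H_order_def k add.commute)
    show "2 * (18 * j + 20) - 3 \<le> card (H_edges k)" unfolding E card_capped by simp
  qed simp
  have seq: "degree_sequence (H_verts k) (H_edges k) =
      replicate_mset (8 * k) 2 + replicate_mset 2 3 + replicate_mset (8 * k) 5 +
      replicate_mset 2 6 + replicate_mset (2 * k - 2) 8"
    unfolding V E degree_sequence_capped by (simp add: k add.commute)
  have filter_rep: "filter_mset P (replicate_mset m d) = (if P d then replicate_mset m d else {#})" for P m and d :: nat
    by (induction m) auto
  have "sp (H_verts k) (H_edges k) (int 2) = 8 * k + 2"
  \<comment> \<open>The window from 2 to 4 contains all vertices of degree 2 and the two of degree
    3.\<close>
  proof (rule sp_eqI[where l = 2])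
    show fin: "finite (H_verts k)" by (simp add: H_verts_def)
    have window: "card {v \<in> H_verts k. m \<le> degree (H_edges k) v \<and> degree (H_edges k) v \<le> m + 2} =
        (if m \<le> 2 \<and> 2 \<le> m + 2 then 8 * k else 0) + (if m \<le> 3 \<and> 3 \<le> m + 2 then 2 else 0) +
        (if m \<le> 5 \<and> 5 \<le> m + 2 then 8 * k else 0) + (if m \<le> 6 \<and> 6 \<le> m + 2 then 2 else 0) +
        (if m \<le> 8 \<and> 8 \<le> m + 2 then 2 * k - 2 else 0)" for m
    proof -
      have "card {v \<in> H_verts k. m \<le> degree (H_edges k) v \<and> degree (H_edges k) v \<le> m + 2} =
          size (filter_mset (\<lambda>d. m \<le> d \<and> d \<le> m + 2) (degree_sequence (H_verts k) (H_edges k)))"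
        by (rule card_degree_window[OF fin, where P = "\<lambda>d. m \<le> d \<and> d \<le> m + 2"])
      then show ?thesis unfolding seq filter_union_mset filter_rep by (simp only: size_union if_distrib[of size] size_replicate_mset size_empty)
    qed
    \<comment> \<open>The other windows with many vertices contain the 5s together with either the
      3s or the 6s; the 6s and 8s together amount to only 2k.\<close>
    show "card {v \<in> H_verts k. m \<le> degree (H_edges k) v \<and> degree (H_edges k) v \<le> m + 2} \<le> 8 * k + 2" for m
      unfolding window using assms(1) by auto
    show "card {v \<in> H_verts k. 2 \<le> degree (H_edges k) v \<and> degree (H_edges k) v \<le> 2 + 2} = 8 * k + 2"
      unfolding window by simp
  qed simp
  then have "sp (H_verts k) (H_edges k) 2 = 8 * k + 2" by simp
  then show ?thesis
    using chords maximal seq assms(2) by simp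
qed

end
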